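(* Consider the linear structural error-in-variables model $y_i=\beta\xi_i+\alpha+\delta_i$, $x_i=\xi_i+\varepsilon_i$, $i\ge1$, with real-valued slope $\beta$ and i.i.d. explanatory variables $\{\xi,\xi_i,i\ge1\}$. Assume (A) and (C) of the context and that $E|\xi|^{8/3}<\infty$, which, in turn, implies (B) of the context. Let $0<\gamma<1$. Then, both for the no-intercept version ($\alpha$ known to be zero, $c=0$) and the unknown intercept version ($c=1$) of the model, from the central limit theorems (a) and (b) of the context, respective large-sample approximate $1-\gamma$ confidence intervals for $\beta$ are $$\left[B_k^1(n,z_{\gamma/2}),\,B_k^2(n,z_{\gamma/2})\right],\qquad k=1\text{ and }2,$$ (that is, the probability that the interval contains $\beta$ converges to $1-\gamma$ as $n\to\infty$; $k=1$ corresponds to (a) and $k=2$ to (b)), where for $l=1$ and $2$, $$B_k^l(n,z_{\gamma/2})=\frac{f_k(n)(S_{xy}-\mu)^2\widehat\beta_{1n}-z_{\gamma/2}^2\sum_{i=1}^n(s_{i,yy}-g_k^{yy})(s_{i,xy}-g_k^{xy})+(-1)^l\sqrt{\dfrac{D_k(n,z_{\gamma/2})}{4}}}{f_k(n)(S_{xy}-\mu)^2-z_{\gamma/2}^2\sum_{i=1}^n(s_{i,xy}-g_k^{xy})^2},$$ with $$f_1(n)=n(n-1),\quad f_2(n)=n^2,\quad g_1^{yy}=S_{yy},\quad g_2^{yy}=\lambda\theta,\quad g_1^{xy}=S_{xy},\quad g_2^{xy}=\mu,$$ and $$D_k(n,z_{\gamma/2})=4z_{\gamma/2}^2f_k(n)(S_{xy}-\mu)^2\sum_{i=1}^n\Big((s_{i,yy}-g_k^{yy})-\widehat\beta_{1n}(s_{i,xy}-g_k^{xy})\Big)^2$$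 $$-4z_{\gamma/2}^4\left(\sum_{i=1}^n(s_{i,yy}-g_k^{yy})^2\sum_{i=1}^n(s_{i,xy}-g_k^{xy})^2-\Big(\sum_{i=1}^n(s_{i,yy}-g_k^{yy})(s_{i,xy}-g_k^{xy})\Big)^2\right).$$
   Context: Assumptions. (A) $\{(\delta,\varepsilon),(\delta_i,\varepsilon_i),i\ge1\}$ is a sequence of i.i.d. random vectors with mean zero, $E\delta^4<\infty$, $E\varepsilon^4<\infty$, and positive definite covariance matrix $\Gamma=\begin{pmatrix}\lambda\theta&\mu\\ \mu&\theta\end{pmatrix}$, i.e. $\mathrm{Var}\,\delta=\lambda\theta$, $\mathrm{Var}\,\varepsilon=\theta$, $\mathrm{cov}(\delta,\varepsilon)=\mu$; here $\lambda\theta$ and $\mu$ are known while $\theta$ is unknown. (B) $\{\xi,\xi_i,i\ge1\}$ are i.i.d. random variables in the domain of attraction of the normal law, i.e. there are constants $a_n$ and $b_n$, $b_n>0$, for which $(\sum_{i=1}^n\xi_i-a_n)b_n^{-1}\xrightarrow{\mathcal D}N(0,1)$ as $n\to\infty$. (C) $(\delta,\varepsilon)$ and $\xi$ are independent; in the structural model the explanatory variables $\xi_i$ are independent of the error terms $(\delta_i,\varepsilon_i)$. Notation. For real-valued variables $u_i,v_i$, $1\le i\le n$: $\overline u=\frac1n\sum_{i=1}^nu_i$, $s_{i,uv}=(u_i-c\,\overline u)(v_i-c\,\overline v)$, $S_{uv}=\frac1n\sum_{i=1}^ns_{i,uv}$, where $c=0$ if $\alpha$ is known to be zero and $c=1$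 if $\alpha$ is unknown. $\widehat\beta_{1n}=\dfrac{S_{yy}-\lambda\theta}{S_{xy}-\mu}$, if $S_{xy}-\mu\neq0$ and $S_{yy}-\lambda\theta>0$. $z_{\gamma/2}$ is the $100(1-\gamma/2)$th percentile of the standard normal distribution. With $u_i(1,n)=(s_{i,yy}-\lambda\theta)-\beta(s_{i,xy}-\mu)$ and $\overline{u(1,n)}=\frac1n\sum_{i=1}^nu_i(1,n)$, the central limit theorems from which the intervals are obtained are, as $n\to\infty$: (a) $\sqrt n\,(S_{xy}-\mu)(\widehat\beta_{1n}-\beta)\big(\sum_{i=1}^n(u_i(1,n)-\overline{u(1,n)})^2/(n-1)\big)^{-1/2}\xrightarrow{\mathcal D}N(0,1)$; (b) $n\,(S_{xy}-\mu)(\widehat\beta_{1n}-\beta)\big(\sum_{i=1}^nu_i^2(1,n)\big)^{-1/2}\xrightarrow{\mathcal D}N(0,1)$.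
   Formalization: Adds that β ≠ 0 (for β = 0 the estimator is undefined with non-vanishing probability and coverage does not tend to 1−γ) and that ξ is not almost surely constant (a constant ξ has all moments but cannot satisfy (B)). *)

theory Defs
  imports "HOL-Probability.Probability"
begin

section \<open>Probabilistic notions\<close>

text \<open>The member with index 0 of a family \<^term>\<open>X :: nat \<Rightarrow> _\<close> plays the role of the generic copy
  (written without an index on paper); the observations are the members with index at least 1.\<close>

definition (in prob_space) iid :: "'b measure \<Rightarrow> (nat \<Rightarrow> 'a \<Rightarrow> 'b) \<Rightarrow> bool" where
  "iid N X \<longleftrightarrow> indep_vars (\<lambda>_. N) X UNIV \<and> (\<forall>i. distr M N (X i) = distr M N (X 0))"

text \<open>As \<^const>\<open>prob_space.indep_var\<close>, for random variables whose value types may differ.\<close>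

definition (in prob_space) indep_rv ::
    "'b measure \<Rightarrow> ('a \<Rightarrow> 'b) \<Rightarrow> 'c measure \<Rightarrow> ('a \<Rightarrow> 'c) \<Rightarrow> bool" where
  "indep_rv N X L Y \<longleftrightarrow> random_variable N X \<and> random_variable L Y \<and>
     indep_set {X -` A \<inter> space M | A. A \<in> sets N} {Y -` A \<inter> space M | A. A \<in> sets L}"

definition (in prob_space) covariance :: "('a \<Rightarrow> real) \<Rightarrow> ('a \<Rightarrow> real) \<Rightarrow> real" where
  "covariance U V = expectation (\<lambda>\<omega>. (U \<omega> - expectation U) * (V \<omega> - expectation V))"

definition (in prob_space) covariance_matrix :: "('a \<Rightarrow> real) \<Rightarrow> ('a \<Rightarrow> real) \<Rightarrow> real^2^2" where
  "covariance_matrix U V =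
     vector [vector [variance U, covariance U V], vector [covariance V U, variance V]]"

definition positive_definite :: "real^'n^'n \<Rightarrow> bool" where
  "positive_definite A \<longleftrightarrow> transpose A = A \<and> (\<forall>v. v \<noteq> 0 \<longrightarrow> v \<bullet> (A *v v) > 0)"

text \<open>Domain of attraction of the normal law, for the partial sums of \<^term>\<open>X 1\<close>, \<^term>\<open>X 2\<close>, ...\<close>

definition (in prob_space) normal_attraction :: "(nat \<Rightarrow> 'a \<Rightarrow> real) \<Rightarrow> bool" where
  "normal_attraction X \<longleftrightarrow>
     (\<exists>a b :: nat \<Rightarrow> real. (\<forall>n. b n > 0) \<and>
        weak_conv_m (\<lambda>n. distr M borel (\<lambda>\<omega>. ((\<Sum>i=1..n. X i \<omega>) - a n) / b n))
          std_normal_distribution)"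

definition std_normal_quantile :: "real \<Rightarrow> real" where
  "std_normal_quantile p = Inf {t. p \<le> cdf std_normal_distribution t}"


section \<open>Sample statistics\<close>

text \<open>Data are sequences of reals of which only the entries with indices 1 to \<open>n\<close> are used.
  The argument \<open>v\<^sub>\<delta>\<close> stands for the known error variance Var \<open>\<delta>\<close> (the product of \<open>\<lambda>\<close> and \<open>\<theta>\<close>),
  and \<open>\<mu>\<close> for the known error covariance; \<open>\<theta>\<close> itself is not available to any statistic.\<close>

definition sample_mean :: "nat \<Rightarrow> (nat \<Rightarrow> real) \<Rightarrow> real" where
  "sample_mean n u = (\<Sum>i=1..n. u i) / real n"

definition s_term :: "real \<Rightarrow> nat \<Rightarrow> (nat \<Rightarrow> real) \<Rightarrow> (nat \<Rightarrow> real) \<Rightarrow> nat \<Rightarrow> real" where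
  "s_term c n u v i = (u i - c * sample_mean n u) * (v i - c * sample_mean n v)"

definition S_stat :: "real \<Rightarrow> nat \<Rightarrow> (nat \<Rightarrow> real) \<Rightarrow> (nat \<Rightarrow> real) \<Rightarrow> real" where
  "S_stat c n u v = sample_mean n (s_term c n u v)"

definition beta_hat ::
    "real \<Rightarrow> real \<Rightarrow> real \<Rightarrow> nat \<Rightarrow> (nat \<Rightarrow> real) \<Rightarrow> (nat \<Rightarrow> real) \<Rightarrow> real" where
  "beta_hat c v\<^sub>\<delta> \<mu> n x y = (S_stat c n y y - v\<^sub>\<delta>) / (S_stat c n x y - \<mu>)"

definition beta_hat_defined ::
    "real \<Rightarrow> real \<Rightarrow> real \<Rightarrow> nat \<Rightarrow> (nat \<Rightarrow> real) \<Rightarrow> (nat \<Rightarrow> real) \<Rightarrow> bool" where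
  "beta_hat_defined c v\<^sub>\<delta> \<mu> n x y \<longleftrightarrow> S_stat c n x y - \<mu> \<noteq> 0 \<and> S_stat c n y y - v\<^sub>\<delta> > 0"


section \<open>Confidence limits\<close>

text \<open>The index \<open>k\<close> is only used with the values 1 and 2.\<close>

definition f_coef :: "nat \<Rightarrow> nat \<Rightarrow> real" where
  "f_coef k n = (if k = 1 then real n * (real n - 1) else (real n)\<^sup>2)"

definition g_yy :: "nat \<Rightarrow> real \<Rightarrow> real \<Rightarrow> nat \<Rightarrow> (nat \<Rightarrow> real) \<Rightarrow> real" where
  "g_yy k c v\<^sub>\<delta> n y = (if k = 1 then S_stat c n y y else v\<^sub>\<delta>)"

definition g_xy :: "nat \<Rightarrow> real \<Rightarrow> real \<Rightarrow> nat \<Rightarrow> (nat \<Rightarrow> real) \<Rightarrow> (nat \<Rightarrow> real) \<Rightarrow> real" where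
  "g_xy k c \<mu> n x y = (if k = 1 then S_stat c n x y else \<mu>)"

definition D_stat ::
    "nat \<Rightarrow> real \<Rightarrow> real \<Rightarrow> real \<Rightarrow> real \<Rightarrow> nat \<Rightarrow> (nat \<Rightarrow> real) \<Rightarrow> (nat \<Rightarrow> real) \<Rightarrow> real" where
  "D_stat k c v\<^sub>\<delta> \<mu> z n x y =
     4 * z\<^sup>2 * f_coef k n * (S_stat c n x y - \<mu>)\<^sup>2 *
       (\<Sum>i=1..n. ((s_term c n y y i - g_yy k c v\<^sub>\<delta> n y)
                   - beta_hat c v\<^sub>\<delta> \<mu> n x y * (s_term c n x y i - g_xy k c \<mu> n x y))\<^sup>2)
     - 4 * z ^ 4 *
       ((\<Sum>i=1..n. (s_term c n y y i - g_yy k c v\<^sub>\<delta> n y)\<^sup>2) *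
        (\<Sum>i=1..n. (s_term c n x y i - g_xy k c \<mu> n x y)\<^sup>2)
        - (\<Sum>i=1..n. (s_term c n y y i - g_yy k c v\<^sub>\<delta> n y) *
                     (s_term c n x y i - g_xy k c \<mu> n x y))\<^sup>2)"

definition B_denom ::
    "nat \<Rightarrow> real \<Rightarrow> real \<Rightarrow> real \<Rightarrow> nat \<Rightarrow> (nat \<Rightarrow> real) \<Rightarrow> (nat \<Rightarrow> real) \<Rightarrow> real" where
  "B_denom k c \<mu> z n x y =
     f_coef k n * (S_stat c n x y - \<mu>)\<^sup>2
     - z\<^sup>2 * (\<Sum>i=1..n. (s_term c n x y i - g_xy k c \<mu> n x y)\<^sup>2)"

definition B_limit ::
    "nat \<Rightarrow> nat \<Rightarrow> real \<Rightarrow> real \<Rightarrow> real \<Rightarrow> real \<Rightarrow> nat \<Rightarrow> (nat \<Rightarrow> real) \<Rightarrow> (nat \<Rightarrow> real) \<Rightarrow> real" where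
  "B_limit k l c v\<^sub>\<delta> \<mu> z n x y =
     (f_coef k n * (S_stat c n x y - \<mu>)\<^sup>2 * beta_hat c v\<^sub>\<delta> \<mu> n x y
      - z\<^sup>2 * (\<Sum>i=1..n. (s_term c n y y i - g_yy k c v\<^sub>\<delta> n y) *
                        (s_term c n x y i - g_xy k c \<mu> n x y))
      + (-1) ^ l * sqrt (D_stat k c v\<^sub>\<delta> \<mu> z n x y / 4))
     / B_denom k c \<mu> z n x y"

text \<open>Division by zero and square roots of negative numbers are total functions in HOL.
  The following predicate says that no such convention is used in the confidence limits.\<close>

definition limits_defined ::
    "nat \<Rightarrow> real \<Rightarrow> real \<Rightarrow> real \<Rightarrow> real \<Rightarrow> nat \<Rightarrow> (nat \<Rightarrow> real) \<Rightarrow> (nat \<Rightarrow> real) \<Rightarrow> bool" where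
  "limits_defined k c v\<^sub>\<delta> \<mu> z n x y \<longleftrightarrow>
     beta_hat_defined c v\<^sub>\<delta> \<mu> n x y \<and> D_stat k c v\<^sub>\<delta> \<mu> z n x y \<ge> 0 \<and> B_denom k c \<mu> z n x y \<noteq> 0"

end

theory Submission
  imports Defs
begin

text \<open>Write \<open>w_i = \<beta> * (\<xi>_i - c * E \<xi>) + \<delta>_i\<close>, \<open>\<eta>_i = \<delta>_i - \<beta> * \<epsilon>_i\<close> and
  \<open>v_i = w_i * \<eta>_i - (\<lambda> * \<theta> - \<beta> * \<mu>)\<close>. The coverage event is shown to agree, up to events of
  vanishing probability, with the event that the standardized sum of the i.i.d. centred variables \<open>v_i\<close>,
  slightly perturbed, is at most \<open>z\<close> in absolute value.

  Algebra. That the studentized estimation error is at most \<open>z\<close> in absolute value is, after squaring, a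
  quadratic inequality in \<open>\<beta>\<close>. The confidence limits are its roots, \<open>D / 4\<close> is its quarter discriminant
  and the common denominator its leading coefficient. Where that coefficient is positive, the
  discriminant is nonnegative because the inequality holds at the estimate, and hence the interval
  contains \<open>\<beta>\<close> if and only if the inequality holds at \<open>\<beta>\<close> (\<open>limits_defined_and_covers_iff\<close>).

  Probability. The residuals \<open>u_i\<close> are the \<open>v_i\<close> up to terms with the factors \<open>c * mean w\<close> and
  \<open>c * mean \<eta>\<close>. These change the mean of the \<open>u_i\<close> by a product of two centred sample means, which is
  negligible against the inverse square root of \<open>n\<close>, and do not change the limit of the mean of the
  \<open>u_i\<^sup>2\<close>. As \<open>\<xi>\<close> has a finite second moment, the errors have fourth moments and both are independent,
  \<open>v_i\<close> has a finite variance, and this variance is positive because neither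
  \<open>\<xi>\<close> nor \<open>\<eta>\<close> is degenerate and \<open>\<beta> \<noteq> 0\<close>
  (\<open>structural_moments\<close>). So the central limit theorem holds for the \<open>v_i\<close>, the law of large numbers for
  the \<open>u_i\<^sup>2\<close>, and a sandwich argument gives the limit \<open>2 * \<Phi> z - 1 = 1 - \<gamma>\<close>
  (\<open>prob_of_CLT_perturbed\<close>, \<open>interval_coverage\<close>).

  Positive leading coefficient. Divided by \<open>n\<^sup>2\<close>, its first term tends to the square of
  \<open>\<beta> * E (\<xi> - c * E \<xi>)\<^sup>2\<close>, which is not zero. The term subtracted from it is of the form
  \<open>(\<Sum>i=1..n. X_i\<^sup>2) / n\<^sup>2\<close> where \<open>X_i\<close> is integrable but its square contains \<open>\<xi>\<close> in the fourth power; it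
  vanishes since the maximum of \<open>n\<close> integrable i.i.d. variables is of smaller order than \<open>n\<close>
  (\<open>tendsto_prob_sum_squares\<close>).\<close>

section \<open>Convergence in probability to a constant\<close>

lemma tendsto_0_of_le:
  fixes f g :: "nat \<Rightarrow> real"
  assumes le: "\<And>n. f n \<le> g n" and g: "g \<longlonglongrightarrow> c"
    and nonneg: "\<And>n. 0 \<le> f n" and c: "c = 0"
  shows "f \<longlonglongrightarrow> 0"
  using g c le nonneg by (intro Lim_null_comparison[of f g]) (auto intro!: always_eventually)

definition (in prob_space) tendsto_prob :: "(nat \<Rightarrow> 'a \<Rightarrow> real) \<Rightarrow> real \<Rightarrow> bool" where
  "tendsto_prob X a \<longleftrightarrow> (\<forall>n. X n \<in> borel_measurable M) \<and>
     (\<forall>e>0. (\<lambda>n. prob {\<omega>\<in>space M. e \<le> \<bar>X n \<omega> - a\<bar>}) \<longlonglongrightarrow> 0)"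

context prob_space
begin

lemma tendsto_prob_measurable: "tendsto_prob X a \<Longrightarrow> X n \<in> borel_measurable M"
  by (simp add: tendsto_prob_def)

lemma tendsto_probI:
  assumes "\<And>n. X n \<in> borel_measurable M"
    and "\<And>e. e > 0 \<Longrightarrow> (\<lambda>n. prob {\<omega>\<in>space M. e \<le> \<bar>X n \<omega> - a\<bar>}) \<longlonglongrightarrow> 0"
  shows "tendsto_prob X a"
  using assms by (simp add: tendsto_prob_def)

lemma tendsto_probD:
  "tendsto_prob X a \<Longrightarrow> e > 0 \<Longrightarrow> (\<lambda>n. prob {\<omega>\<in>space M. e \<le> \<bar>X n \<omega> - a\<bar>}) \<longlonglongrightarrow> 0"
  by (simp add: tendsto_prob_def)

lemma tendsto_prob_const: "a \<longlonglongrightarrow> l \<Longrightarrow> tendsto_prob (\<lambda>n _. a n) l"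
proof (rule tendsto_probI)
  fix e :: real assume a: "a \<longlonglongrightarrow> l" and e: "e > 0"
  have "eventually (\<lambda>n. \<bar>a n - l\<bar> < e) sequentially"
    using tendstoD[OF a e] by (simp add: dist_real_def)
  then have "eventually (\<lambda>n. prob {\<omega>\<in>space M. e \<le> \<bar>a n - l\<bar>} = 0) sequentially"
    by eventually_elim simp
  then show "(\<lambda>n. prob {\<omega>\<in>space M. e \<le> \<bar>a n - l\<bar>}) \<longlonglongrightarrow> 0"
    by (rule tendsto_eventually)
qed simp

text \<open>The continuous mapping theorem for two arguments: by continuity, a deviation of the image forces a
  deviation of one of the arguments. The rules for arithmetic, absolute values and roots follow.\<close>

lemma tendsto_prob_continuous:
  fixes f :: "real \<Rightarrow> real \<Rightarrow> real"
  assumes X: "tendsto_prob X a" and Y: "tendsto_prob Y b"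
    and cont: "isCont (\<lambda>p. f (fst p) (snd p)) (a, b)"
    and f: "\<And>n. (\<lambda>\<omega>. f (X n \<omega>) (Y n \<omega>)) \<in> borel_measurable M"
  shows "tendsto_prob (\<lambda>n \<omega>. f (X n \<omega>) (Y n \<omega>)) (f a b)"
proof (rule tendsto_probI[OF f])
  fix e :: real assume "e > 0"
  note [measurable] = X[THEN tendsto_prob_measurable] Y[THEN tendsto_prob_measurable] f
  obtain d where d: "d > 0"
      "\<And>p. dist p (a, b) < d \<Longrightarrow> dist (f (fst p) (snd p)) (f a b) < e"
    using cont \<open>e > 0\<close> unfolding continuous_at_eps_delta by (auto simp: dist_commute)
  let ?A = "\<lambda>n. {\<omega>\<in>space M. d/2 \<le> \<bar>X n \<omega> - a\<bar>}"
  let ?B = "\<lambda>n. {\<omega>\<in>space M. d/2 \<le> \<bar>Y n \<omega> - b\<bar>}"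
  have "\<bar>f s t - f a b\<bar> < e" if "\<bar>s - a\<bar> < d/2" "\<bar>t - b\<bar> < d/2" for s t
  proof -
    have "dist (s, t) (a, b) \<le> \<bar>s - a\<bar> + \<bar>t - b\<bar>"
      unfolding dist_prod_def dist_real_def by (simp add: sqrt_sum_squares_le_sum_abs)
    then show ?thesis using d(2)[of "(s,t)"] that by (simp add: dist_real_def)
  qed
  then have sub: "{\<omega>\<in>space M. e \<le> \<bar>f (X n \<omega>) (Y n \<omega>) - f a b\<bar>} \<subseteq> ?A n \<union> ?B n" for n
    by (force simp: not_le[symmetric])
  have "prob {\<omega>\<in>space M. e \<le> \<bar>f (X n \<omega>) (Y n \<omega>) - f a b\<bar>} \<le> prob (?A n) + prob (?B n)" for n
    by (rule order.trans[OF finite_measure_mono[OF sub] measure_Un_le]) measurable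
  moreover have "(\<lambda>n. prob (?A n) + prob (?B n)) \<longlonglongrightarrow> 0 + 0"
    using d(1) by (intro tendsto_add tendsto_probD[OF X] tendsto_probD[OF Y]) auto
  ultimately show "(\<lambda>n. prob {\<omega>\<in>space M. e \<le> \<bar>f (X n \<omega>) (Y n \<omega>) - f a b\<bar>}) \<longlonglongrightarrow> 0"
    by (rule tendsto_0_of_le) simp_all
qed

lemma tendsto_prob_add:
  "tendsto_prob X a \<Longrightarrow> tendsto_prob Y b \<Longrightarrow> tendsto_prob (\<lambda>n \<omega>. X n \<omega> + Y n \<omega>) (a + b)"
  by (rule tendsto_prob_continuous[where f = "(+)"])
     (assumption | erule tendsto_prob_measurable | intro continuous_intros borel_measurable_add)+

lemma tendsto_prob_diff:
  "tendsto_prob X a \<Longrightarrow> tendsto_prob Y b \<Longrightarrow> tendsto_prob (\<lambda>n \<omega>. X n \<omega> - Y n \<omega>) (a - b)"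
  by (rule tendsto_prob_continuous[where f = "(-)"])
     (assumption | erule tendsto_prob_measurable | intro continuous_intros borel_measurable_diff)+

lemma tendsto_prob_mult:
  "tendsto_prob X a \<Longrightarrow> tendsto_prob Y b \<Longrightarrow> tendsto_prob (\<lambda>n \<omega>. X n \<omega> * Y n \<omega>) (a * b)"
  by (rule tendsto_prob_continuous[where f = "(*)"])
     (assumption | erule tendsto_prob_measurable | intro continuous_intros borel_measurable_times)+

lemma tendsto_prob_power2: "tendsto_prob X a \<Longrightarrow> tendsto_prob (\<lambda>n \<omega>. (X n \<omega>)\<^sup>2) (a\<^sup>2)"
  unfolding power2_eq_square by (rule tendsto_prob_mult)

lemma tendsto_prob_abs: "tendsto_prob X a \<Longrightarrow> tendsto_prob (\<lambda>n \<omega>. \<bar>X n \<omega>\<bar>) \<bar>a\<bar>"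
  by (rule tendsto_prob_continuous[where f = "\<lambda>s _. \<bar>s\<bar>" and Y = X and b = a])
     (assumption | erule tendsto_prob_measurable | intro continuous_intros borel_measurable_abs)+

lemma tendsto_prob_sqrt: "tendsto_prob X a \<Longrightarrow> tendsto_prob (\<lambda>n \<omega>. sqrt (X n \<omega>)) (sqrt a)"
proof -
  assume X: "tendsto_prob X a"
  note [measurable] = X[THEN tendsto_prob_measurable]
  show ?thesis
    by (rule tendsto_prob_continuous[where f = "\<lambda>s _. sqrt s", OF X X])
       (auto intro!: continuous_intros)
qed

lemma tendsto_prob_eventually_cong:
  assumes X: "tendsto_prob X a" and Y: "\<And>n. Y n \<in> borel_measurable M"
    and eq: "\<forall>\<^sub>F n in sequentially. \<forall>\<omega>\<in>space M. X n \<omega> = Y n \<omega>"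
  shows "tendsto_prob Y a"
proof (rule tendsto_probI[OF Y])
  fix e :: real assume "e > 0"
  then have "(\<lambda>n. prob {\<omega>\<in>space M. e \<le> \<bar>X n \<omega> - a\<bar>}) \<longlonglongrightarrow> 0"
    by (rule tendsto_probD[OF X])
  moreover have "\<forall>\<^sub>F n in sequentially.
      prob {\<omega>\<in>space M. e \<le> \<bar>X n \<omega> - a\<bar>} = prob {\<omega>\<in>space M. e \<le> \<bar>Y n \<omega> - a\<bar>}"
    using eq by eventually_elim (auto intro!: arg_cong[where f = prob])
  ultimately show "(\<lambda>n. prob {\<omega>\<in>space M. e \<le> \<bar>Y n \<omega> - a\<bar>}) \<longlonglongrightarrow> 0"
    by (rule Lim_transform_eventually)
qed

lemma tendsto_prob_0_squeeze:
  assumes X: "tendsto_prob X 0" and Y: "\<And>n. Y n \<in> borel_measurable M"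
    and le: "\<And>n \<omega>. \<omega> \<in> space M \<Longrightarrow> \<bar>Y n \<omega>\<bar> \<le> X n \<omega>"
  shows "tendsto_prob Y 0"
proof (rule tendsto_probI[OF Y])
  fix e :: real assume "e > 0"
  note [measurable] = X[THEN tendsto_prob_measurable] Y
  have "prob {\<omega>\<in>space M. e \<le> \<bar>Y n \<omega> - 0\<bar>} \<le> prob {\<omega>\<in>space M. e \<le> \<bar>X n \<omega> - 0\<bar>}" for n
  proof (rule finite_measure_mono)
    show "{\<omega>\<in>space M. e \<le> \<bar>Y n \<omega> - 0\<bar>} \<subseteq> {\<omega>\<in>space M. e \<le> \<bar>X n \<omega> - 0\<bar>}"
      using le by (auto intro: order.trans[OF _ order.trans[OF le abs_ge_self]])
  qed measurable
  moreover have "(\<lambda>n. prob {\<omega>\<in>space M. e \<le> \<bar>X n \<omega> - 0\<bar>}) \<longlonglongrightarrow> 0"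
    using \<open>e > 0\<close> by (rule tendsto_probD[OF X])
  ultimately show "(\<lambda>n. prob {\<omega>\<in>space M. e \<le> \<bar>Y n \<omega> - 0\<bar>}) \<longlonglongrightarrow> 0"
    by (rule tendsto_0_of_le) simp_all
qed

text \<open>Markov's inequality.\<close>

lemma tendsto_prob_L1:
  assumes int: "\<And>n. integrable M (X n)"
    and lim: "(\<lambda>n. expectation (\<lambda>\<omega>. \<bar>X n \<omega> - a\<bar>)) \<longlonglongrightarrow> 0"
  shows "tendsto_prob X a"
proof (rule tendsto_probI)
  fix e :: real assume "e > 0"
  have "prob {\<omega>\<in>space M. e \<le> \<bar>X n \<omega> - a\<bar>} \<le> expectation (\<lambda>\<omega>. \<bar>X n \<omega> - a\<bar>) / e" for n
    by (rule integral_Markov_inequality_measure[where A = "space M"]) (use int \<open>e > 0\<close> in auto)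
  moreover have "(\<lambda>n. expectation (\<lambda>\<omega>. \<bar>X n \<omega> - a\<bar>) / e) \<longlonglongrightarrow> 0 / e"
    using lim by (rule tendsto_divide) (use \<open>e > 0\<close> in auto)
  ultimately show "(\<lambda>n. prob {\<omega>\<in>space M. e \<le> \<bar>X n \<omega> - a\<bar>}) \<longlonglongrightarrow> 0"
    by (rule tendsto_0_of_le) simp_all
qed (use int in auto)

lemma prob_le_tendsto_0:
  assumes X: "tendsto_prob X a" and "b < a"
  shows "(\<lambda>n. prob {\<omega>\<in>space M. X n \<omega> \<le> b}) \<longlonglongrightarrow> 0"
proof -
  note [measurable] = X[THEN tendsto_prob_measurable]
  have "prob {\<omega>\<in>space M. X n \<omega> \<le> b} \<le> prob {\<omega>\<in>space M. a - b \<le> \<bar>X n \<omega> - a\<bar>}" for n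
    by (rule finite_measure_mono) (auto, measurable)
  moreover have "(\<lambda>n. prob {\<omega>\<in>space M. a - b \<le> \<bar>X n \<omega> - a\<bar>}) \<longlonglongrightarrow> 0"
    using \<open>b < a\<close> by (intro tendsto_probD[OF X]) simp
  ultimately show ?thesis
    by (rule tendsto_0_of_le) simp_all
qed

end

section \<open>The standard normal distribution and perturbed central limits\<close>

interpretation std_normal: real_distribution std_normal_distribution
  by (rule real_dist_normal_dist)

lemma std_normal_singleton: "measure std_normal_distribution {a} = 0"
  by (subst measure_def, subst emeasure_density)
    (auto simp: emeasure_lborel_singleton nn_integral_0_iff_AE intro!: AE_mp[OF AE_lborel_singleton[of a]])

lemma isCont_cdf_std_normal: "isCont (cdf std_normal_distribution) a"
  by (simp add: std_normal.isCont_cdf std_normal_singleton)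

lemma cdf_std_normal_uminus:
  "cdf std_normal_distribution (- a) = 1 - cdf std_normal_distribution a"
proof -
  have d: "distr std_normal_distribution borel uminus = std_normal_distribution"
  proof -
    have "std_normal_distribution = density (distr lborel borel uminus) std_normal_density"
      by (simp add: lborel_distr_uminus)
    also have "\<dots> = distr (density lborel (\<lambda>x. ennreal (std_normal_density (- x)))) borel uminus"
      by (rule density_distr) auto
    also have "\<dots> = distr std_normal_distribution borel uminus"
      by (simp add: normal_density_def)
    finally show ?thesis by simp
  qed
  have "cdf std_normal_distribution (- a) = measure (distr std_normal_distribution borel uminus) {..- a}"
    by (simp add: cdf_def d)
  also have "\<dots> = measure std_normal_distribution {a..}"
    by (subst measure_distr) (auto intro!: arg_cong[where f = "measure std_normal_distribution"])
  also have "\<dots> = measure std_normal_distribution {a<..}"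
  proof -
    have "{a..} = {a<..} \<union> {a}" by auto
    then show ?thesis
      using std_normal.finite_measure_Union[of "{a<..}" "{a}"] by (simp add: std_normal_singleton)
  qed
  also have "{a<..} = space std_normal_distribution - {..a}" by auto
  also have "measure std_normal_distribution (space std_normal_distribution - {..a}) = 1 - cdf std_normal_distribution a"
    unfolding cdf_def by (rule std_normal.prob_compl) simp
  finally show ?thesis .
qed

text \<open>As the distribution function is continuous, the infimum is attained and no level is skipped.\<close>

lemma std_normal_quantile:
  assumes "0 < p" "p < 1"
  shows "cdf std_normal_distribution (std_normal_quantile p) = p"
proof -
  let ?F = "cdf std_normal_distribution"
  let ?S = "{t. p \<le> ?F t}"
  have cont: "continuous_on UNIV ?F"
    using isCont_cdf_std_normal by (simp add: continuous_on_eq_continuous_at)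
  obtain t where "?F t > p"
    using order_tendstoD(1)[OF std_normal.cdf_lim_at_top_prob assms(2)]
    by (auto simp: eventually_at_top_linorder)
  then have ne: "?S \<noteq> {}" by (auto intro: less_imp_le)
  obtain s where "?F s < p"
    using order_tendstoD(2)[OF std_normal.cdf_lim_at_bot assms(1)]
    by (auto simp: eventually_at_bot_linorder)
  then have bdd: "bdd_below ?S"
    by (intro bdd_belowI[of _ s]) (smt (verit) mem_Collect_eq std_normal.cdf_nondecreasing)
  have "closed ?S"
    by (intro closed_Collect_le continuous_intros cont)
  then have "Inf ?S \<in> ?S"
    by (rule closed_contains_Inf[OF ne bdd])
  moreover have "\<not> ?F (Inf ?S) > p"
  proof
    assume "?F (Inf ?S) > p"
    then have "eventually (\<lambda>t. ?F t > p) (at (Inf ?S))"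
      using isCont_cdf_std_normal[of "Inf ?S"] unfolding isCont_def by (auto dest: order_tendstoD(1))
    then obtain d where d: "d > 0" "\<And>t. t \<noteq> Inf ?S \<Longrightarrow> dist t (Inf ?S) < d \<Longrightarrow> ?F t > p"
      by (auto simp: eventually_at)
    have "?F (Inf ?S - d/2) > p"
      by (rule d(2)) (use d(1) in \<open>auto simp: dist_real_def\<close>)
    then have "Inf ?S \<le> Inf ?S - d/2" by (intro cInf_lower bdd) auto
    with d(1) show False by simp
  qed
  ultimately show ?thesis by (simp add: std_normal_quantile_def)
qed

lemma measure_std_normal_symmetric_interval:
  assumes "0 \<le> t"
  shows "measure std_normal_distribution {-t..t} = 2 * cdf std_normal_distribution t - 1"
proof -
  have "{..t} = {..-t} \<union> ({-t..t} - {-t})" using assms by auto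
  then have "cdf std_normal_distribution t = cdf std_normal_distribution (-t)
      + measure std_normal_distribution ({-t..t} - {-t})"
    unfolding cdf_def by (subst std_normal.finite_measure_Union[symmetric]) auto
  also have "measure std_normal_distribution ({-t..t} - {-t}) = measure std_normal_distribution {-t..t}"
    using assms by (subst std_normal.finite_measure_Diff) (auto simp: std_normal_singleton)
  finally show ?thesis by (simp add: cdf_std_normal_uminus)
qed

lemma std_normal_quantile_pos:
  assumes "1/2 < p" "p < 1"
  shows "0 < std_normal_quantile p"
proof (rule ccontr)
  assume "\<not> 0 < std_normal_quantile p"
  then have "cdf std_normal_distribution (std_normal_quantile p) \<le> cdf std_normal_distribution 0"
    by (intro std_normal.cdf_nondecreasing) simp
  moreover have "cdf std_normal_distribution 0 = 1/2"
    using cdf_std_normal_uminus[of 0] by simp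
  ultimately show False using std_normal_quantile[of p] assms by simp
qed

context prob_space
begin

lemma prob_abs_le_of_CLT:
  assumes Z: "\<And>n. Z n \<in> borel_measurable M"
    and clt: "weak_conv_m (\<lambda>n. distr M borel (Z n)) std_normal_distribution"
    and "0 < t"
  shows "(\<lambda>n. prob {\<omega>\<in>space M. \<bar>Z n \<omega>\<bar> \<le> t}) \<longlonglongrightarrow> 2 * cdf std_normal_distribution t - 1"
proof -
  have "frontier {-t..t} = {-t, t}"
    using \<open>0 < t\<close> by (auto simp: frontier_def)
  moreover have "measure std_normal_distribution {-t, t} = 0"
    using \<open>0 < t\<close> std_normal.finite_measure_Union[of "{-t}" "{t}"]
    by (simp add: std_normal_singleton insert_commute)
  ultimately have "(\<lambda>n. measure (distr M borel (Z n)) {-t..t}) \<longlonglongrightarrow> measure std_normal_distribution {-t..t}"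
    by (intro weak_conv_imp_continuity_set_conv real_dist_normal_dist clt real_distribution_distr Z)
       (auto simp: std_normal.emeasure_eq_measure)
  moreover have "measure (distr M borel (Z n)) {-t..t} = prob {\<omega>\<in>space M. \<bar>Z n \<omega>\<bar> \<le> t}" for n
    by (subst measure_distr[OF Z]) (auto intro!: arg_cong[where f = prob])
  ultimately show ?thesis
    using \<open>0 < t\<close> by (simp add: measure_std_normal_symmetric_interval)
qed

text \<open>The form of Slutsky's theorem used for the coverage probability. The event \<open>E n\<close> lies between
  \<open>\<bar>Z n\<bar> \<le> z - err n\<close> and \<open>\<bar>Z n\<bar> \<le> z + err n\<close>, up to exceptional events \<open>bad n\<close> of vanishing
  probability; since the error vanishes in probability and the limit distribution function is
  continuous, the sandwich closes. The exceptional events absorb the samples for which the confidence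
  limits are not defined or their denominator is not positive.\<close>

lemma prob_of_CLT_perturbed:
  assumes Z: "\<And>n. Z n \<in> borel_measurable M"
    and clt: "weak_conv_m (\<lambda>n. distr M borel (Z n)) std_normal_distribution"
    and "0 < z"
    and err: "tendsto_prob err 0"
    and E: "\<And>n. E n \<in> events" and bad: "\<And>n. bad n \<in> events"
    and bad_0: "(\<lambda>n. prob (bad n)) \<longlonglongrightarrow> 0"
    and inner: "\<And>n \<omega>. n \<ge> n0 \<Longrightarrow> \<omega> \<in> space M - bad n \<Longrightarrow> \<bar>Z n \<omega>\<bar> \<le> z - err n \<omega> \<Longrightarrow> \<omega> \<in> E n"
    and outer: "\<And>n \<omega>. n \<ge> n0 \<Longrightarrow> \<omega> \<in> E n - bad n \<Longrightarrow> \<bar>Z n \<omega>\<bar> \<le> z + err n \<omega>"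
  shows "(\<lambda>n. prob (E n)) \<longlonglongrightarrow> 2 * cdf std_normal_distribution z - 1"
proof -
  note [measurable] = Z E bad err[THEN tendsto_prob_measurable]
  let ?G = "\<lambda>t. 2 * cdf std_normal_distribution t - 1"
  let ?P = "\<lambda>n t. prob {\<omega>\<in>space M. \<bar>Z n \<omega>\<bar> \<le> t}"
  let ?bad = "\<lambda>n e. {\<omega>\<in>space M. e \<le> \<bar>err n \<omega> - 0\<bar>}"
  have bd: "(\<lambda>n. prob (bad n) + prob (?bad n e)) \<longlonglongrightarrow> 0 + 0" if "e > 0" for e
    by (intro tendsto_add bad_0 tendsto_probD[OF err] that)
  have G: "isCont ?G z" by (intro continuous_intros isCont_cdf_std_normal)
  have bds: "?P n (z - e) \<le> prob (E n) + (prob (bad n) + prob (?bad n e))"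
       "prob (E n) \<le> ?P n (z + e) + (prob (bad n) + prob (?bad n e))" if "n \<ge> n0" for n e
  proof -
    have "{\<omega>\<in>space M. \<bar>Z n \<omega>\<bar> \<le> z - e} \<subseteq> E n \<union> (bad n \<union> ?bad n e)"
      using inner[OF that] by fastforce
    then have "?P n (z - e) \<le> prob (E n \<union> (bad n \<union> ?bad n e))"
      by (rule finite_measure_mono) measurable
    also have "\<dots> \<le> prob (E n) + prob (bad n \<union> ?bad n e)"
      by (rule measure_Un_le) measurable
    also have "prob (bad n \<union> ?bad n e) \<le> prob (bad n) + prob (?bad n e)"
      by (rule measure_Un_le) measurable
    finally show "?P n (z - e) \<le> prob (E n) + (prob (bad n) + prob (?bad n e))" by simp
    have "E n \<subseteq> {\<omega>\<in>space M. \<bar>Z n \<omega>\<bar> \<le> z + e} \<union> (bad n \<union> ?bad n e)"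
      using outer[OF that] sets.sets_into_space[OF E[of n]] by fastforce
    then have "prob (E n) \<le> prob ({\<omega>\<in>space M. \<bar>Z n \<omega>\<bar> \<le> z + e} \<union> (bad n \<union> ?bad n e))"
      by (rule finite_measure_mono) measurable
    also have "\<dots> \<le> ?P n (z + e) + prob (bad n \<union> ?bad n e)"
      by (rule measure_Un_le) measurable
    also have "prob (bad n \<union> ?bad n e) \<le> prob (bad n) + prob (?bad n e)"
      by (rule measure_Un_le) measurable
    finally show "prob (E n) \<le> ?P n (z + e) + (prob (bad n) + prob (?bad n e))" by simp
  qed
  show ?thesis
  proof (rule order_tendstoI)
    fix a assume a: "a < ?G z"
    then have "eventually (\<lambda>t. a < ?G t) (at z)"
      using G unfolding isCont_def by (auto dest: order_tendstoD(1))
    then obtain d where d: "d > 0" "\<And>t. t \<noteq> z \<Longrightarrow> dist t z < d \<Longrightarrow> a < ?G t"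
      by (auto simp: eventually_at)
    define e where "e = min (d/2) (z/2)"
    have e: "e > 0" "z - e > 0" "a < ?G (z - e)"
      using d(1) \<open>0 < z\<close> by (auto simp: e_def min_def dist_real_def intro!: d(2))
    have "(\<lambda>n. ?P n (z - e) - (prob (bad n) + prob (?bad n e))) \<longlonglongrightarrow> ?G (z - e) - (0 + 0)"
      by (intro tendsto_diff bd e prob_abs_le_of_CLT Z clt)
    then have "eventually (\<lambda>n. a < ?P n (z - e) - (prob (bad n) + prob (?bad n e))) sequentially"
      using e(3) by (intro order_tendstoD(1)) auto
    with eventually_ge_at_top[of n0] show "eventually (\<lambda>n. a < prob (E n)) sequentially"
      by eventually_elim (use bds(1)[of _ e] in force)
  next
    fix a assume a: "?G z < a"
    then have "eventually (\<lambda>t. ?G t < a) (at z)"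
      using G unfolding isCont_def by (auto dest: order_tendstoD(2))
    then obtain d where d: "d > 0" "\<And>t. t \<noteq> z \<Longrightarrow> dist t z < d \<Longrightarrow> ?G t < a"
      by (auto simp: eventually_at)
    define e where "e = d/2"
    have e: "e > 0" "z + e > 0" "?G (z + e) < a"
      using d(1) \<open>0 < z\<close> by (auto simp: e_def dist_real_def intro!: d(2))
    have "(\<lambda>n. ?P n (z + e) + (prob (bad n) + prob (?bad n e))) \<longlonglongrightarrow> ?G (z + e) + (0 + 0)"
      by (intro tendsto_add[OF prob_abs_le_of_CLT bd] e Z clt)
    then have "eventually (\<lambda>n. ?P n (z + e) + (prob (bad n) + prob (?bad n e)) < a) sequentially"
      using e(3) by (intro order_tendstoD(2)) auto
    with eventually_ge_at_top[of n0] show "eventually (\<lambda>n. prob (E n) < a) sequentially"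
      by eventually_elim (use bds(2)[of _ e] in force)
  qed
qed

end

section \<open>Limit theorems for independent identically distributed variables\<close>

context prob_space
begin

lemma iidD:
  assumes "iid N X"
  shows iid_measurable: "X i \<in> M \<rightarrow>\<^sub>M N"
    and iid_distr: "distr M N (X i) = distr M N (X 0)"
    and iid_indep_vars: "indep_vars (\<lambda>_. N) X UNIV"
  using assms by (auto simp: iid_def indep_vars_def)

lemma iid_compose:
  assumes X: "iid N X" and [measurable]: "g \<in> N \<rightarrow>\<^sub>M L"
  shows "iid L (\<lambda>i \<omega>. g (X i \<omega>))"
  unfolding iid_def
proof (intro conjI allI)
  show "indep_vars (\<lambda>_. L) (\<lambda>i \<omega>. g (X i \<omega>)) UNIV"
    by (rule indep_vars_compose2[OF iid_indep_vars[OF X]]) simp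
  fix i
  note [measurable] = iid_measurable[OF X]
  have "distr M L (\<lambda>\<omega>. g (X j \<omega>)) = distr (distr M N (X j)) L g" for j
    by (subst distr_distr) (auto simp: comp_def)
  then show "distr M L (\<lambda>\<omega>. g (X i \<omega>)) = distr M L (\<lambda>\<omega>. g (X 0 \<omega>))"
    using iid_distr[OF X, of i] by simp
qed

lemma iid_integrable:
  fixes X :: "nat \<Rightarrow> 'a \<Rightarrow> real"
  assumes X: "iid borel X" and int: "integrable M (X 0)"
  shows "integrable M (X i)"
proof -
  note [measurable] = iid_measurable[OF X]
  have "integrable (distr M borel (X j)) (\<lambda>x. x) \<longleftrightarrow> integrable M (X j)" for j
    by (subst integrable_distr_eq) auto
  then show ?thesis using iid_distr[OF X, of i] int by metis
qed

lemma iid_expectation: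
  fixes X :: "nat \<Rightarrow> 'a \<Rightarrow> real"
  assumes X: "iid borel X"
  shows "expectation (X i) = expectation (X 0)"
proof -
  note [measurable] = iid_measurable[OF X]
  have "integral\<^sup>L (distr M borel (X j)) (\<lambda>x. x) = expectation (X j)" for j
    by (subst integral_distr) auto
  then show ?thesis using iid_distr[OF X, of i] by metis
qed

lemma sample_mean_measurable [measurable (raw)]:
  "(\<And>i. X i \<in> borel_measurable M) \<Longrightarrow> (\<lambda>\<omega>. sample_mean n (\<lambda>i. X i \<omega>)) \<in> borel_measurable M"
  unfolding sample_mean_def
  by (intro borel_measurable_divide borel_measurable_sum borel_measurable_const)

lemma iid_expectation_sample_mean:
  fixes X :: "nat \<Rightarrow> 'a \<Rightarrow> real"
  assumes X: "iid borel X" and int: "integrable M (X 0)" and "n \<ge> 1"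
  shows "integrable M (\<lambda>\<omega>. sample_mean n (\<lambda>i. X i \<omega>))"
    and "expectation (\<lambda>\<omega>. sample_mean n (\<lambda>i. X i \<omega>)) = expectation (X 0)"
proof -
  note int' = iid_integrable[OF X int]
  show "integrable M (\<lambda>\<omega>. sample_mean n (\<lambda>i. X i \<omega>))"
    unfolding sample_mean_def by (intro integrable_divide Bochner_Integration.integrable_sum int')
  have "expectation (\<lambda>\<omega>. sample_mean n (\<lambda>i. X i \<omega>)) = (\<Sum>i=1..n. expectation (X i)) / real n"
    unfolding sample_mean_def by (simp add: Bochner_Integration.integral_sum int')
  also have "\<dots> = expectation (X 0)"
    using \<open>n \<ge> 1\<close> by (subst sum.cong[OF refl iid_expectation[OF X]]) simp
  finally show "expectation (\<lambda>\<omega>. sample_mean n (\<lambda>i. X i \<omega>)) = expectation (X 0)" .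
qed

text \<open>The mixed products have expectation zero by pairwise independence.\<close>

lemma iid_sample_mean_square:
  fixes X :: "nat \<Rightarrow> 'a \<Rightarrow> real"
  assumes X: "iid borel X" and int: "integrable M (\<lambda>\<omega>. (X 0 \<omega>)\<^sup>2)"
    and mean: "expectation (X 0) = 0"
  shows "integrable M (\<lambda>\<omega>. (sample_mean n (\<lambda>i. X i \<omega>))\<^sup>2)"
    and "expectation (\<lambda>\<omega>. (sample_mean n (\<lambda>i. X i \<omega>))\<^sup>2) = expectation (\<lambda>\<omega>. (X 0 \<omega>)\<^sup>2) / real n"
proof -
  note [measurable] = iid_measurable[OF X]
  have X2: "iid borel (\<lambda>i \<omega>. (X i \<omega>)\<^sup>2)"
    by (rule iid_compose[OF X]) simp
  have int2: "integrable M (\<lambda>\<omega>. (X i \<omega>)\<^sup>2)" for i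
    by (rule iid_integrable[OF X2 int])
  have int1: "integrable M (X i)" for i
    by (rule square_integrable_imp_integrable[OF _ int2]) simp
  have mean_i: "expectation (X i) = 0" for i
    using iid_expectation[OF X, of i] mean by simp
  have mult: "integrable M (\<lambda>\<omega>. X i \<omega> * X j \<omega>) \<and>
      expectation (\<lambda>\<omega>. X i \<omega> * X j \<omega>) = (if i = j then expectation (\<lambda>\<omega>. (X 0 \<omega>)\<^sup>2) else 0)" for i j
  proof (cases "i = j")
    case True
    then show ?thesis
      using int2[of j] iid_expectation[OF X2, of j] by (simp add: power2_eq_square)
  next
    case False
    have iv: "indep_vars (\<lambda>_. borel) X {i, j}"
      by (rule indep_vars_subset[OF iid_indep_vars[OF X]]) simp
    show ?thesis
      using indep_vars_integrable[OF _ iv int1] indep_vars_lebesgue_integral[OF _ iv int1] False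
      by (simp add: mean_i)
  qed
  have sq: "(sample_mean n (\<lambda>i. X i \<omega>))\<^sup>2 = (\<Sum>i=1..n. \<Sum>j=1..n. X i \<omega> * X j \<omega>) / (real n)\<^sup>2" for \<omega>
    by (simp add: sample_mean_def power_divide power2_eq_square sum_product)
  show "integrable M (\<lambda>\<omega>. (sample_mean n (\<lambda>i. X i \<omega>))\<^sup>2)"
    unfolding sq using mult by (intro integrable_divide Bochner_Integration.integrable_sum) auto
  show "expectation (\<lambda>\<omega>. (sample_mean n (\<lambda>i. X i \<omega>))\<^sup>2) = expectation (\<lambda>\<omega>. (X 0 \<omega>)\<^sup>2) / real n"
  proof -
    have "expectation (\<lambda>\<omega>. (sample_mean n (\<lambda>i. X i \<omega>))\<^sup>2)
        = (\<Sum>i=1..n. \<Sum>j=1..n. expectation (\<lambda>\<omega>. X i \<omega> * X j \<omega>)) / (real n)\<^sup>2"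
      unfolding sq
      by (subst integral_divide_zero, subst Bochner_Integration.integral_sum)
         (use mult in \<open>auto intro!: sum.cong Bochner_Integration.integral_sum simp: Bochner_Integration.integrable_sum\<close>)
    also have "\<dots> = (\<Sum>i=1..n. \<Sum>j=1..n. if i = j then expectation (\<lambda>\<omega>. (X 0 \<omega>)\<^sup>2) else 0) / (real n)\<^sup>2"
      using mult by (simp only:)
    also have "\<dots> = expectation (\<lambda>\<omega>. (X 0 \<omega>)\<^sup>2) / real n"
      by (simp add: power2_eq_square[of "real n"])
    finally show ?thesis .
  qed
qed

lemma expectation_tail_tendsto_0:
  fixes X :: "'a \<Rightarrow> real"
  assumes int: "integrable M X" and "d > 0"
  shows "(\<lambda>n. expectation (\<lambda>\<omega>. if d * real n < \<bar>X \<omega>\<bar> then \<bar>X \<omega>\<bar> else 0)) \<longlonglongrightarrow> 0"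
proof -
  note [measurable] = borel_measurable_integrable[OF int]
  have "(\<lambda>n. expectation (\<lambda>\<omega>. if d * real n < \<bar>X \<omega>\<bar> then \<bar>X \<omega>\<bar> else 0)) \<longlonglongrightarrow> expectation (\<lambda>\<omega>. 0)"
  proof (rule integral_dominated_convergence[where w = "\<lambda>\<omega>. \<bar>X \<omega>\<bar>"])
    show "AE \<omega> in M. (\<lambda>n. if d * real n < \<bar>X \<omega>\<bar> then \<bar>X \<omega>\<bar> else 0) \<longlonglongrightarrow> 0"
    proof (intro AE_I2 tendsto_eventually)
      fix \<omega>
      obtain k :: nat where k: "\<bar>X \<omega>\<bar> / d < real k" using reals_Archimedean2 by blast
      have "\<bar>X \<omega>\<bar> \<le> d * real n" if "n \<ge> k" for n
      proof -
        have "\<bar>X \<omega>\<bar> / d \<le> real n" using k that by linarith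
        then show ?thesis using \<open>d > 0\<close> by (simp add: field_simps)
      qed
      then show "\<forall>\<^sub>F n in sequentially. (if d * real n < \<bar>X \<omega>\<bar> then \<bar>X \<omega>\<bar> else 0) = 0"
        by (auto simp: eventually_sequentially not_less[symmetric] intro!: exI[of _ k])
    qed
  qed (use int in auto)
  then show ?thesis by simp
qed

text \<open>Truncation: the part of \<open>X i\<close> bounded by \<open>K\<close> has a variance, so that its centred sample mean vanishes
  in mean square, while the remainder is small in mean, uniformly in the sample size.\<close>

theorem weak_law_of_large_numbers:
  fixes X :: "nat \<Rightarrow> 'a \<Rightarrow> real"
  assumes X: "iid borel X" and int: "integrable M (X 0)"
  shows "tendsto_prob (\<lambda>n \<omega>. sample_mean n (\<lambda>i. X i \<omega>)) (expectation (X 0))"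
proof (rule tendsto_prob_L1)
  note [measurable] = iid_measurable[OF X]
  let ?m = "expectation (X 0)"
  show "integrable M (\<lambda>\<omega>. sample_mean n (\<lambda>i. X i \<omega>))" for n
    unfolding sample_mean_def
    by (intro integrable_divide Bochner_Integration.integrable_sum iid_integrable[OF X int])
  show "(\<lambda>n. expectation (\<lambda>\<omega>. \<bar>sample_mean n (\<lambda>i. X i \<omega>) - ?m\<bar>)) \<longlonglongrightarrow> 0"
  proof (rule LIMSEQ_I)
    fix e :: real assume "e > 0"
    \<comment> \<open>a quarter of \<open>e\<close> each is allotted to the two tails and to the two terms bounding the truncated part\<close>
    obtain K :: nat where K: "expectation (\<lambda>\<omega>. if 1 * real K < \<bar>X 0 \<omega>\<bar> then \<bar>X 0 \<omega>\<bar> else 0) < e / 4"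
    proof -
      have "e / 4 > 0" using \<open>e > 0\<close> by simp
      from order_tendstoD(2)[OF expectation_tail_tendsto_0[OF int zero_less_one] this]
      show ?thesis using that by (auto simp: eventually_sequentially)
    qed
    define h where "h = (\<lambda>s::real. if \<bar>s\<bar> \<le> real K then s else 0)"
    have [measurable]: "h \<in> borel_measurable borel" unfolding h_def by measurable
    define mh where "mh = expectation (\<lambda>\<omega>. h (X 0 \<omega>))"
    define Y where "Y = (\<lambda>i \<omega>. h (X i \<omega>) - mh)"
    define R where "R = (\<lambda>i \<omega>. \<bar>X i \<omega> - h (X i \<omega>)\<bar>)"
    have Y: "iid borel Y" unfolding Y_def by (rule iid_compose[OF X, where g = "\<lambda>s. h s - mh"]) simp
    have R: "iid borel R" unfolding R_def by (rule iid_compose[OF X, where g = "\<lambda>s. \<bar>s - h s\<bar>"]) simp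
    have inth: "integrable M (\<lambda>\<omega>. h (X 0 \<omega>))"
      by (rule integrable_const_bound[where B = "real K"]) (auto simp: h_def)
    have intY2: "integrable M (\<lambda>\<omega>. (Y 0 \<omega>)\<^sup>2)"
    proof (rule integrable_const_bound[where B = "(real K + \<bar>mh\<bar>)\<^sup>2"])
      have "(Y 0 \<omega>)\<^sup>2 \<le> (real K + \<bar>mh\<bar>)\<^sup>2" for \<omega>
        by (rule abs_le_square_iff[THEN iffD1]) (auto simp: Y_def h_def)
      then show "AE \<omega> in M. norm ((Y 0 \<omega>)\<^sup>2) \<le> (real K + \<bar>mh\<bar>)\<^sup>2" by simp
    qed (auto simp: Y_def)
    have meanY: "expectation (Y 0) = 0"
      unfolding Y_def using inth by (simp add: mh_def prob_space)
    have intR: "integrable M (R 0)"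
      unfolding R_def using int inth by auto
    have meanR: "expectation (R 0) < e / 4"
    proof -
      have "R 0 = (\<lambda>\<omega>. if 1 * real K < \<bar>X 0 \<omega>\<bar> then \<bar>X 0 \<omega>\<bar> else 0)"
        by (auto simp: R_def h_def fun_eq_iff)
      with K show ?thesis by simp
    qed
    have m_mh: "\<bar>?m - mh\<bar> \<le> expectation (R 0)"
    proof -
      have "?m - mh = expectation (\<lambda>\<omega>. X 0 \<omega> - h (X 0 \<omega>))"
        using int inth by (simp add: mh_def)
      also have "\<bar>\<dots>\<bar> \<le> expectation (R 0)" unfolding R_def by (rule integral_abs_bound)
      finally show ?thesis .
    qed
    define s where "s = expectation (\<lambda>\<omega>. (Y 0 \<omega>)\<^sup>2)"
    have "s \<ge> 0" by (simp add: s_def)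
    obtain N :: nat where N: "16 * s / e\<^sup>2 < real N" using reals_Archimedean2 by blast
    have "expectation (\<lambda>\<omega>. \<bar>sample_mean n (\<lambda>i. X i \<omega>) - ?m\<bar>) < e" if n: "n \<ge> max N 1" for n
    proof -
      have n0: "n \<ge> 1" "real n > 0" using n by auto
      have pt: "\<bar>sample_mean n (\<lambda>i. X i \<omega>) - ?m\<bar> \<le>
         e / 4 + 4 / e * (sample_mean n (\<lambda>i. Y i \<omega>))\<^sup>2 + sample_mean n (\<lambda>i. R i \<omega>) + expectation (R 0)" for \<omega>
      proof -
        have "sample_mean n (\<lambda>i. X i \<omega>) = sample_mean n (\<lambda>i. Y i \<omega>) + mh
            + sample_mean n (\<lambda>i. X i \<omega> - h (X i \<omega>))"
          using n0 by (simp add: sample_mean_def Y_def sum_subtractf diff_divide_distrib)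
        moreover have "\<bar>sample_mean n (\<lambda>i. X i \<omega> - h (X i \<omega>))\<bar> \<le> sample_mean n (\<lambda>i. R i \<omega>)"
          unfolding sample_mean_def R_def using n0 by (simp add: divide_right_mono sum_abs)
        moreover have "\<bar>t\<bar> \<le> e / 4 + 4 / e * t\<^sup>2" for t :: real
        proof (cases "\<bar>t\<bar> \<le> e / 4")
          case True
          then show ?thesis using \<open>e > 0\<close> by (simp add: add_increasing2)
        next
          case False
          then have "\<bar>t\<bar> * (e / 4) \<le> \<bar>t\<bar> * \<bar>t\<bar>" by (intro mult_left_mono) auto
          then have "\<bar>t\<bar> \<le> 4 / e * t\<^sup>2"
            using \<open>e > 0\<close> by (simp add: field_simps power2_eq_square)
          then show ?thesis using \<open>e > 0\<close> by simp
        qed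
        ultimately show ?thesis using m_mh by (smt (verit))
      qed
      have "expectation (\<lambda>\<omega>. \<bar>sample_mean n (\<lambda>i. X i \<omega>) - ?m\<bar>) \<le>
        expectation (\<lambda>\<omega>. e / 4 + 4 / e * (sample_mean n (\<lambda>i. Y i \<omega>))\<^sup>2 + sample_mean n (\<lambda>i. R i \<omega>) + expectation (R 0))"
        using iid_expectation_sample_mean(1)[OF X int n0(1)] iid_expectation_sample_mean(1)[OF R intR n0(1)]
          iid_sample_mean_square(1)[OF Y intY2 meanY, of n]
        by (intro integral_mono pt) auto
      also have "\<dots> = e / 4 + 4 / e * (s / real n) + expectation (R 0) + expectation (R 0)"
        using iid_expectation_sample_mean[OF R intR n0(1)]
          iid_sample_mean_square[OF Y intY2 meanY, of n]
        by (simp add: prob_space s_def)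
      also have "4 / e * (s / real n) < e / 4"
      proof -
        have "16 * s / e\<^sup>2 < real n" using N n by linarith
        then show ?thesis using \<open>e > 0\<close> n0 by (simp add: field_simps power2_eq_square)
      qed
      finally show ?thesis using meanR by simp
    qed
    then show "\<exists>no. \<forall>n\<ge>no. norm (expectation (\<lambda>\<omega>. \<bar>sample_mean n (\<lambda>i. X i \<omega>) - ?m\<bar>) - 0) < e"
      by (intro exI[of _ "max N 1"]) simp
  qed
qed

text \<open>A centred sample mean is of the order of the inverse square root of the sample size. A product of two
  such means is therefore negligible even after multiplication by that square root.\<close>

lemma tendsto_prob_sqrt_times_mean_square:
  fixes X :: "nat \<Rightarrow> 'a \<Rightarrow> real"
  assumes X: "iid borel X" and int: "integrable M (\<lambda>\<omega>. (X 0 \<omega>)\<^sup>2)"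
    and mean: "expectation (X 0) = 0"
  shows "tendsto_prob (\<lambda>n \<omega>. sqrt (real n) * (sample_mean n (\<lambda>i. X i \<omega>))\<^sup>2) 0"
proof (rule tendsto_prob_L1)
  note sq = iid_sample_mean_square[OF X int mean]
  show "integrable M (\<lambda>\<omega>. sqrt (real n) * (sample_mean n (\<lambda>i. X i \<omega>))\<^sup>2)" for n
    by (intro integrable_mult_right sq)
  have "(\<lambda>n. s / sqrt (real n)) \<longlonglongrightarrow> 0" for s
    by (rule real_tendsto_divide_at_top[OF tendsto_const
          filterlim_compose[OF sqrt_at_top filterlim_real_sequentially]])
  from this[of "expectation (\<lambda>\<omega>. (X 0 \<omega>)\<^sup>2)"]
  have "(\<lambda>n. expectation (\<lambda>\<omega>. (X 0 \<omega>)\<^sup>2) / sqrt (real n)) \<longlonglongrightarrow> 0" .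
  moreover have "sqrt (real n) * (expectation (\<lambda>\<omega>. (X 0 \<omega>)\<^sup>2) / real n) = expectation (\<lambda>\<omega>. (X 0 \<omega>)\<^sup>2) / sqrt (real n)" for n
    by (cases "n = 0") (auto simp: field_simps)
  ultimately show "(\<lambda>n. expectation (\<lambda>\<omega>. \<bar>sqrt (real n) * (sample_mean n (\<lambda>i. X i \<omega>))\<^sup>2 - 0\<bar>)) \<longlonglongrightarrow> 0"
    by (simp add: abs_mult sq)
qed

text \<open>The case of interest is that of squares without expectation. Integrability of \<open>X\<close> gives that the largest of the
  first \<open>n\<close> variables is at most \<open>d * n\<close> with a probability tending to one, for every \<open>d > 0\<close>, and then the
  sum of the squares is at most \<open>d * n\<close> times the sum of the absolute values.\<close>

lemma tendsto_prob_sum_squares: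
  fixes X :: "nat \<Rightarrow> 'a \<Rightarrow> real"
  assumes X: "iid borel X" and int: "integrable M (X 0)"
  shows "tendsto_prob (\<lambda>n \<omega>. sample_mean n (\<lambda>i. (X i \<omega>)\<^sup>2) / real n) 0"
proof (rule tendsto_probI)
  note [measurable] = iid_measurable[OF X]
  show "random_variable borel (\<lambda>\<omega>. sample_mean n (\<lambda>i. (X i \<omega>)\<^sup>2) / real n)" for n by measurable
  fix e :: real assume "e > 0"
  define a where "a = expectation (\<lambda>\<omega>. \<bar>X 0 \<omega>\<bar>)"
  have "a \<ge> 0" by (simp add: a_def)
  \<comment> \<open>if no \<open>\<bar>X i\<bar>\<close> exceeds \<open>d * n\<close>, a mean of the \<open>\<bar>X i\<bar>\<close> below \<open>a + 1\<close> keeps the statistic below \<open>d * (a + 1) = e\<close>\<close>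
  define d where "d = e / (a + 1)"
  have d: "d > 0" "e / d = a + 1" using \<open>e > 0\<close> \<open>a \<ge> 0\<close> by (auto simp: d_def)
  let ?tail = "\<lambda>n i \<omega>. if d * real n < \<bar>X i \<omega>\<bar> then \<bar>X i \<omega>\<bar> else 0"
  let ?max = "\<lambda>n. {\<omega>\<in>space M. \<exists>i\<in>{1..n}. d * real n < \<bar>X i \<omega>\<bar>}"
  let ?mean = "\<lambda>n. {\<omega>\<in>space M. 1 \<le> \<bar>sample_mean n (\<lambda>i. \<bar>X i \<omega>\<bar>) - a\<bar>}"
  have absX: "iid borel (\<lambda>i \<omega>. \<bar>X i \<omega>\<bar>)" by (rule iid_compose[OF X]) simp
  have inta: "integrable M (\<lambda>\<omega>. \<bar>X 0 \<omega>\<bar>)" using int by simp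
  have max: "prob (?max n) \<le> expectation (?tail n 0) / d" for n
  proof (cases "n = 0")
    case True
    then show ?thesis using d by simp
  next
    case False
    have tail: "iid borel (?tail n)" for n
      by (rule iid_compose[OF X, where g = "\<lambda>s. if d * real n < \<bar>s\<bar> then \<bar>s\<bar> else 0"]) simp
    have inttail: "integrable M (?tail n i)" for i
      by (rule Bochner_Integration.integrable_bound[OF iid_integrable[OF X int, of i]]) auto
    have "?max n = (\<Union>i\<in>{1..n}. {\<omega>\<in>space M. d * real n < \<bar>X i \<omega>\<bar>})" by auto
    also have "prob \<dots> \<le> (\<Sum>i\<in>{1..n}. prob {\<omega>\<in>space M. d * real n < \<bar>X i \<omega>\<bar>})"
      by (rule finite_measure_subadditive_finite) auto
    also have "\<dots> \<le> (\<Sum>i\<in>{1..n}. expectation (?tail n 0) / (d * real n))"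
    proof (rule sum_mono)
      fix i
      have "prob {\<omega>\<in>space M. d * real n < \<bar>X i \<omega>\<bar>} \<le> prob {\<omega>\<in>space M. d * real n \<le> ?tail n i \<omega>}"
        by (rule finite_measure_mono) auto
      also have "\<dots> \<le> expectation (?tail n i) / (d * real n)"
        by (rule integral_Markov_inequality_measure[where A = "space M"]) (use d False inttail in auto)
      also have "expectation (?tail n i) = expectation (?tail n 0)"
        by (rule iid_expectation[OF tail])
      finally show "prob {\<omega>\<in>space M. d * real n < \<bar>X i \<omega>\<bar>} \<le> expectation (?tail n 0) / (d * real n)" .
    qed
    also have "\<dots> = expectation (?tail n 0) / d" using False by simp
    finally show ?thesis .
  qed
  have sub: "{\<omega>\<in>space M. e \<le> \<bar>sample_mean n (\<lambda>i. (X i \<omega>)\<^sup>2) / real n - 0\<bar>} \<subseteq> ?max n \<union> ?mean n" for n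
  proof safe
    fix \<omega> assume \<omega>: "\<omega> \<in> space M" "e \<le> \<bar>sample_mean n (\<lambda>i. (X i \<omega>)\<^sup>2) / real n - 0\<bar>" "\<not> 1 \<le> \<bar>sample_mean n (\<lambda>i. \<bar>X i \<omega>\<bar>) - a\<bar>"
    have n: "n > 0" using \<omega>(2) \<open>e > 0\<close> by (intro Nat.gr0I) auto
    have "\<exists>i\<in>{1..n}. d * real n < \<bar>X i \<omega>\<bar>"
    proof (rule ccontr)
      assume "\<not> (\<exists>i\<in>{1..n}. d * real n < \<bar>X i \<omega>\<bar>)"
      then have le: "\<And>i. i \<in> {1..n} \<Longrightarrow> \<bar>X i \<omega>\<bar> \<le> d * real n" by (auto simp: not_less)
      have "(\<Sum>i=1..n. (X i \<omega>)\<^sup>2) \<le> (\<Sum>i=1..n. d * real n * \<bar>X i \<omega>\<bar>)"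
      proof (rule sum_mono)
        fix i assume "i \<in> {1..n}"
        then have "\<bar>X i \<omega>\<bar> * \<bar>X i \<omega>\<bar> \<le> d * real n * \<bar>X i \<omega>\<bar>"
          by (intro mult_right_mono le) auto
        then show "(X i \<omega>)\<^sup>2 \<le> d * real n * \<bar>X i \<omega>\<bar>" by (simp add: power2_eq_square)
      qed
      then have "sample_mean n (\<lambda>i. (X i \<omega>)\<^sup>2) / real n \<le> d * sample_mean n (\<lambda>i. \<bar>X i \<omega>\<bar>)"
        using n by (simp add: sample_mean_def sum_distrib_left[symmetric] field_simps)
      moreover have "0 \<le> sample_mean n (\<lambda>i. (X i \<omega>)\<^sup>2) / real n"
        by (simp add: sample_mean_def sum_nonneg)
      ultimately have "e \<le> d * sample_mean n (\<lambda>i. \<bar>X i \<omega>\<bar>)" using \<omega>(2) by simp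
      moreover have "e = d * (a + 1)" using d by (simp add: field_simps)
      ultimately have "a + 1 \<le> sample_mean n (\<lambda>i. \<bar>X i \<omega>\<bar>)"
        using d(1) by (simp only: mult_le_cancel_left_pos)
      with \<omega>(3) show False by auto
    qed
    then show "\<exists>i\<in>{1..n}. d * real n < \<bar>X i \<omega>\<bar>" .
  qed
  have "prob {\<omega>\<in>space M. e \<le> \<bar>sample_mean n (\<lambda>i. (X i \<omega>)\<^sup>2) / real n - 0\<bar>}
      \<le> expectation (?tail n 0) / d + prob (?mean n)" for n
  proof -
    have "prob {\<omega>\<in>space M. e \<le> \<bar>sample_mean n (\<lambda>i. (X i \<omega>)\<^sup>2) / real n - 0\<bar>} \<le> prob (?max n \<union> ?mean n)"
      by (rule finite_measure_mono[OF sub]) measurable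
    also have "\<dots> \<le> prob (?max n) + prob (?mean n)"
      by (rule measure_Un_le) measurable
    finally show ?thesis using max[of n] by simp
  qed
  moreover have "(\<lambda>n. expectation (?tail n 0) / d + prob (?mean n)) \<longlonglongrightarrow> 0 / d + 0"
    using d tendsto_probD[OF weak_law_of_large_numbers[OF absX inta] zero_less_one]
    by (intro tendsto_add tendsto_divide tendsto_const expectation_tail_tendsto_0[OF int]) (auto simp: a_def)
  ultimately show "(\<lambda>n. prob {\<omega>\<in>space M. e \<le> \<bar>sample_mean n (\<lambda>i. (X i \<omega>)\<^sup>2) / real n - 0\<bar>}) \<longlonglongrightarrow> 0"
    by (rule tendsto_0_of_le) simp_all
qed

text \<open>The samples start at index 1, the central limit theorem sums from index 0.\<close>

lemma iid_Suc:
  assumes X: "iid N X"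
  shows "iid N (\<lambda>i. X (Suc i))"
  unfolding iid_def
proof (intro conjI allI)
  let ?F = "\<lambda>i. {X i -` A \<inter> space M |A. A \<in> sets N}"
  have ind: "indep_sets ?F UNIV"
    using iid_indep_vars[OF X] by (simp add: indep_vars_def2)
  have "indep_sets (\<lambda>i. ?F (Suc i)) UNIV"
  proof (rule indep_setsI)
    show "?F (Suc i) \<subseteq> events" for i
      using iid_measurable[OF X] by (auto intro: measurable_sets)
    fix A J assume J: "J \<noteq> {}" "J \<subseteq> UNIV" "finite J" and A: "\<forall>j\<in>J. A j \<in> ?F (Suc j)"
    have "prob (\<Inter>j\<in>Suc ` J. A (j - 1)) = (\<Prod>j\<in>Suc ` J. prob (A (j - 1)))"
      by (rule indep_setsD[OF ind]) (use J A in auto)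
    then show "prob (\<Inter>j\<in>J. A j) = (\<Prod>j\<in>J. prob (A j))"
      by (simp add: prod.reindex)
  qed
  then show "indep_vars (\<lambda>_. N) (\<lambda>i. X (Suc i)) UNIV"
    using iid_measurable[OF X] by (simp add: indep_vars_def2)
  show "distr M N (X (Suc i)) = distr M N (X (Suc 0))" for i
    using iid_distr[OF X, of "Suc i"] iid_distr[OF X, of "Suc 0"] by simp
qed

lemma iid_central_limit:
  fixes X :: "nat \<Rightarrow> 'a \<Rightarrow> real"
  assumes X: "iid borel X" and int: "integrable M (\<lambda>\<omega>. (X 0 \<omega>)\<^sup>2)"
    and var: "variance (X 0) = \<sigma>\<^sup>2" and "\<sigma> > 0"
  shows "weak_conv_m (\<lambda>n. distr M borel (\<lambda>\<omega>. (\<Sum>i=1..n. X i \<omega> - expectation (X 0)) / sqrt (real n * \<sigma>\<^sup>2)))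
           std_normal_distribution"
proof -
  note [measurable] = iid_measurable[OF X]
  note X' = iid_Suc[OF X]
  have sq: "iid borel (\<lambda>i \<omega>. (X i \<omega>)\<^sup>2)" by (rule iid_compose[OF X]) simp
  have dev: "iid borel (\<lambda>i \<omega>. (X i \<omega> - expectation (X 0))\<^sup>2)"
    by (rule iid_compose[OF X, where g = "\<lambda>s. (s - expectation (X 0))\<^sup>2"]) simp
  have "weak_conv_m (\<lambda>n. distr M borel (\<lambda>\<omega>. (\<Sum>i<n. X (Suc i) \<omega> - expectation (X 0)) / sqrt (real n * \<sigma>\<^sup>2)))
           std_normal_distribution"
  proof (rule central_limit_theorem[where \<mu> = "distr M borel (X 0)"])
    show "indep_vars (\<lambda>i. borel) (\<lambda>i. X (Suc i)) UNIV" by (rule iid_indep_vars[OF X'])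
    show "expectation (X (Suc n)) = expectation (X 0)" for n by (rule iid_expectation[OF X])
    then show "variance (X (Suc n)) = \<sigma>\<^sup>2" for n
      using iid_expectation[OF dev, of "Suc n"] var by simp
    show "integrable M (\<lambda>\<omega>. (X (Suc n) \<omega>)\<^sup>2)" for n by (rule iid_integrable[OF sq int])
    show "distr M borel (X (Suc n)) = distr M borel (X 0)" for n by (rule iid_distr[OF X])
  qed fact
  moreover have "(\<Sum>i<n. X (Suc i) \<omega> - expectation (X 0)) = (\<Sum>i=1..n. X i \<omega> - expectation (X 0))" for n \<omega>
    by (simp add: sum.atLeast1_atMost_eq)
  ultimately show ?thesis by simp
qed

lemma iid_normal_attraction:
  fixes X :: "nat \<Rightarrow> 'a \<Rightarrow> real"
  assumes X: "iid borel X" and int: "integrable M (\<lambda>\<omega>. (X 0 \<omega>)\<^sup>2)"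
    and pos: "variance (X 0) > 0"
  shows "normal_attraction X"
proof -
  define m where "m = expectation (X 0)"
  define \<sigma> where "\<sigma> = sqrt (variance (X 0))"
  have \<sigma>: "\<sigma> > 0" "variance (X 0) = \<sigma>\<^sup>2" using pos by (auto simp: \<sigma>_def)
  \<comment> \<open>the normalization has to be positive for the empty sum, too\<close>
  define b where "b = (\<lambda>n::nat. if n = 0 then 1 else sqrt (real n * \<sigma>\<^sup>2))"
  have eq: "((\<Sum>i=1..n. X i \<omega>) - real n * m) / b n = (\<Sum>i=1..n. X i \<omega> - m) / sqrt (real n * \<sigma>\<^sup>2)" for n \<omega>
    by (simp add: b_def sum_subtractf)
  have "weak_conv_m (\<lambda>n. distr M borel (\<lambda>\<omega>. ((\<Sum>i=1..n. X i \<omega>) - real n * m) / b n)) std_normal_distribution"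
    using iid_central_limit[OF X int \<sigma>(2,1)] by (simp only: eq m_def[symmetric])
  moreover have "\<forall>n. b n > 0" using \<sigma> by (simp add: b_def)
  ultimately show ?thesis
    unfolding normal_attraction_def by (intro exI[of _ "\<lambda>n. real n * m"] exI[of _ b]) simp
qed

end

section \<open>Confidence limits as roots of a quadratic\<close>

text \<open>The inequality for \<open>\<beta>\<close> is a quadratic one with leading coefficient \<open>P\<close> and quarter discriminant
  \<open>D / 4\<close>. The discriminant is nonnegative because the quadratic is not positive at \<open>b\<close>, where its first
  term vanishes.\<close>

lemma quadratic_confidence_set:
  fixes T A B C b \<beta> z :: real
  defines "D \<equiv> 4 * z\<^sup>2 * T * (A - 2 * b * C + b\<^sup>2 * B) - 4 * z ^ 4 * (A * B - C\<^sup>2)"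
    and "P \<equiv> T - z\<^sup>2 * B" and "N \<equiv> T * b - z\<^sup>2 * C"
  assumes P: "P > 0" and nonneg: "A - 2 * b * C + b\<^sup>2 * B \<ge> 0"
  shows "D \<ge> 0"
    and "(N - sqrt (D / 4)) / P \<le> \<beta> \<and> \<beta> \<le> (N + sqrt (D / 4)) / P \<longleftrightarrow>
         T * (b - \<beta>)\<^sup>2 \<le> z\<^sup>2 * (A - 2 * \<beta> * C + \<beta>\<^sup>2 * B)"
proof -
  have key: "(P * t - N)\<^sup>2 - D / 4 = P * (T * (b - t)\<^sup>2 - z\<^sup>2 * (A - 2 * t * C + t\<^sup>2 * B))" for t
    unfolding D_def P_def N_def by algebra
  have "P * (z\<^sup>2 * (A - 2 * b * C + b\<^sup>2 * B)) \<ge> 0"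
    using P nonneg by (intro mult_nonneg_nonneg) auto
  with key[of b] have "D / 4 \<ge> (P * b - N)\<^sup>2" by simp
  with zero_le_power2[of "P * b - N"] show D: "D \<ge> 0" by linarith
  have "(N - sqrt (D / 4)) / P \<le> \<beta> \<and> \<beta> \<le> (N + sqrt (D / 4)) / P \<longleftrightarrow> \<bar>P * \<beta> - N\<bar> \<le> sqrt (D / 4)"
    using P by (auto simp: field_simps abs_le_iff)
  also have "\<dots> \<longleftrightarrow> (P * \<beta> - N)\<^sup>2 \<le> D / 4"
    by (metis real_sqrt_le_iff real_sqrt_abs)
  also have "\<dots> \<longleftrightarrow> P * (T * (b - \<beta>)\<^sup>2 - z\<^sup>2 * (A - 2 * \<beta> * C + \<beta>\<^sup>2 * B)) \<le> 0"
    using key[of \<beta>] by linarith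
  also have "\<dots> \<longleftrightarrow> T * (b - \<beta>)\<^sup>2 \<le> z\<^sup>2 * (A - 2 * \<beta> * C + \<beta>\<^sup>2 * B)"
    using P by (simp add: mult_le_0_iff)
  finally show "(N - sqrt (D / 4)) / P \<le> \<beta> \<and> \<beta> \<le> (N + sqrt (D / 4)) / P \<longleftrightarrow>
         T * (b - \<beta>)\<^sup>2 \<le> z\<^sup>2 * (A - 2 * \<beta> * C + \<beta>\<^sup>2 * B)" .
qed

lemma sum_square_linear_combination:
  fixes a b :: "'i \<Rightarrow> real"
  shows "(\<Sum>i\<in>I. (a i - t * b i)\<^sup>2) = (\<Sum>i\<in>I. (a i)\<^sup>2) - 2 * t * (\<Sum>i\<in>I. a i * b i) + t\<^sup>2 * (\<Sum>i\<in>I. (b i)\<^sup>2)"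
  by (simp add: power2_diff power_mult_distrib sum.distrib sum_subtractf sum_distrib_left mult_ac)

lemma sample_mean_add: "sample_mean n (\<lambda>i. u i + v i) = sample_mean n u + sample_mean n v"
  by (simp add: sample_mean_def sum.distrib add_divide_distrib)

lemma sample_mean_diff: "sample_mean n (\<lambda>i. u i - v i) = sample_mean n u - sample_mean n v"
  by (simp add: sample_mean_def sum_subtractf diff_divide_distrib)

lemma sample_mean_cmult: "sample_mean n (\<lambda>i. a * u i) = a * sample_mean n u"
  by (simp add: sample_mean_def sum_distrib_left)

lemma sample_mean_const: "n \<ge> 1 \<Longrightarrow> sample_mean n (\<lambda>i. a) = a"
  by (simp add: sample_mean_def)

lemma sample_mean_mono: "(\<And>i. u i \<le> v i) \<Longrightarrow> sample_mean n u \<le> sample_mean n v"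
  by (simp add: sample_mean_def divide_right_mono sum_mono)

lemma sample_mean_cong: "(\<And>i. i \<in> {1..n} \<Longrightarrow> u i = v i) \<Longrightarrow> sample_mean n u = sample_mean n v"
  unfolding sample_mean_def by (metis sum.cong)

text \<open>The variables written \<open>u_i(1,n)\<close> in the central limit theorems: linear in the data products, and with
  a sample mean that is the estimation error of the slope times \<open>S_xy - \<mu>\<close>.\<close>

definition residual :: "real \<Rightarrow> real \<Rightarrow> real \<Rightarrow> real \<Rightarrow> nat \<Rightarrow> (nat \<Rightarrow> real) \<Rightarrow> (nat \<Rightarrow> real) \<Rightarrow> nat \<Rightarrow> real" where
  "residual c v \<mu> \<beta> n x y i = (s_term c n y y i - v) - \<beta> * (s_term c n x y i - \<mu>)"

text \<open>Moving the terms with the sample mean to one side turns the studentization by the centred sum of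
  squares with divisor \<open>n - 1\<close> into the one by the raw second moment, at the price of this factor. It
  makes the two kinds of intervals one case, as it tends to 1.\<close>

definition studentizer_weight :: "nat \<Rightarrow> real \<Rightarrow> nat \<Rightarrow> real" where
  "studentizer_weight k z n = (if k = 1 then (real n - 1 + z\<^sup>2) / real n else 1)"

text \<open>The mean of the residuals is \<open>S_xy - \<mu>\<close> times the estimation error, and the data terms in the
  quadratic, taken at \<open>\<beta>\<close>, add up to the sum of the squared residuals, centred ones if \<open>k = 1\<close>.
  So the quadratic inequality compares the mean with the mean square of the residuals.\<close>

lemma limits_defined_and_covers_iff:
  assumes n: "n \<ge> 1" and def: "beta_hat_defined c v \<mu> n x y" and denom: "B_denom k c \<mu> z n x y > 0"
  shows "limits_defined k c v \<mu> z n x y \<and>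
           \<beta> \<in> {B_limit k 1 c v \<mu> z n x y .. B_limit k 2 c v \<mu> z n x y} \<longleftrightarrow>
         studentizer_weight k z n * (real n * (sample_mean n (residual c v \<mu> \<beta> n x y))\<^sup>2)
           \<le> z\<^sup>2 * sample_mean n (\<lambda>i. (residual c v \<mu> \<beta> n x y i)\<^sup>2)"
proof -
  let ?a = "\<lambda>i. s_term c n y y i - g_yy k c v n y"
  let ?b = "\<lambda>i. s_term c n x y i - g_xy k c \<mu> n x y"
  define A where "A = (\<Sum>i=1..n. (?a i)\<^sup>2)"
  define B where "B = (\<Sum>i=1..n. (?b i)\<^sup>2)"
  define C where "C = (\<Sum>i=1..n. ?a i * ?b i)"
  define d where "d = S_stat c n x y - \<mu>"
  define T where "T = f_coef k n * d\<^sup>2"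
  define b where "b = beta_hat c v \<mu> n x y"
  let ?u = "residual c v \<mu> \<beta> n x y"
  let ?U = "sample_mean n ?u"
  have d: "d \<noteq> 0" using def by (simp add: beta_hat_defined_def d_def)
  have sq: "(\<Sum>i=1..n. (?a i - t * ?b i)\<^sup>2) = A - 2 * t * C + t\<^sup>2 * B" for t
    unfolding A_def B_def C_def by (rule sum_square_linear_combination)
  have D: "D_stat k c v \<mu> z n x y = 4 * z\<^sup>2 * T * (A - 2 * b * C + b\<^sup>2 * B) - 4 * z ^ 4 * (A * B - C\<^sup>2)"
    unfolding D_stat_def sq b_def[symmetric] by (simp add: T_def d_def A_def B_def C_def mult_ac)
  have P: "B_denom k c \<mu> z n x y = T - z\<^sup>2 * B"
    by (simp add: B_denom_def T_def d_def B_def)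
  have lim: "B_limit k l c v \<mu> z n x y =
      (T * b - z\<^sup>2 * C + (-1) ^ l * sqrt (D_stat k c v \<mu> z n x y / 4)) / (T - z\<^sup>2 * B)" for l
    by (simp add: B_limit_def P T_def d_def b_def C_def)
  have nonneg: "A - 2 * b * C + b\<^sup>2 * B \<ge> 0"
    unfolding sq[symmetric] by (rule sum_nonneg) simp
  have mean: "?U = (S_stat c n y y - v) - \<beta> * d"
    using n unfolding residual_def[abs_def] d_def S_stat_def
    by (simp add: sample_mean_diff sample_mean_cmult sample_mean_const)
  then have U: "?U = d * (b - \<beta>)"
  proof -
    have "b * d = S_stat c n y y - v"
      using d by (simp add: b_def beta_hat_def d_def[symmetric])
    then show ?thesis unfolding mean by (simp add: algebra_simps)
  qed
  note iff = quadratic_confidence_set[OF denom[unfolded P] nonneg, folded D]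
  have "limits_defined k c v \<mu> z n x y \<and> \<beta> \<in> {B_limit k 1 c v \<mu> z n x y .. B_limit k 2 c v \<mu> z n x y}
      \<longleftrightarrow> T * (b - \<beta>)\<^sup>2 \<le> z\<^sup>2 * (A - 2 * \<beta> * C + \<beta>\<^sup>2 * B)"
    using def denom iff by (simp add: limits_defined_def lim)
  also have "T * (b - \<beta>)\<^sup>2 = f_coef k n * ?U\<^sup>2"
    by (simp add: T_def U power_mult_distrib)
  also have "A - 2 * \<beta> * C + \<beta>\<^sup>2 * B = (\<Sum>i=1..n. (?a i - \<beta> * ?b i)\<^sup>2)"
    by (simp only: sq)
  also have "f_coef k n * ?U\<^sup>2 \<le> z\<^sup>2 * (\<Sum>i=1..n. (?a i - \<beta> * ?b i)\<^sup>2) \<longleftrightarrow>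
      studentizer_weight k z n * (real n * ?U\<^sup>2) \<le> z\<^sup>2 * sample_mean n (\<lambda>i. (?u i)\<^sup>2)"
  proof (cases "k = 1")
    case True
    have "?a i - \<beta> * ?b i = ?u i - ?U" for i
      using True unfolding mean by (simp add: residual_def d_def g_yy_def g_xy_def algebra_simps)
    then have "(\<Sum>i=1..n. (?a i - \<beta> * ?b i)\<^sup>2) = (\<Sum>i=1..n. (?u i - ?U * 1)\<^sup>2)" by simp
    also have "\<dots> = (\<Sum>i=1..n. (?u i)\<^sup>2) - 2 * ?U * (\<Sum>i=1..n. ?u i * 1) + ?U\<^sup>2 * (\<Sum>i=1..n. 1\<^sup>2)"
      by (rule sum_square_linear_combination)
    also have "\<dots> = real n * (sample_mean n (\<lambda>i. (?u i)\<^sup>2) - ?U\<^sup>2)"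
      using n by (simp add: sample_mean_def field_simps power2_eq_square)
    finally have *: "(\<Sum>i=1..n. (?a i - \<beta> * ?b i)\<^sup>2) = real n * (sample_mean n (\<lambda>i. (?u i)\<^sup>2) - ?U\<^sup>2)" .
    have "f_coef k n * ?U\<^sup>2 \<le> z\<^sup>2 * (\<Sum>i=1..n. (?a i - \<beta> * ?b i)\<^sup>2) \<longleftrightarrow>
       real n * ((real n - 1) * ?U\<^sup>2) \<le> real n * (z\<^sup>2 * (sample_mean n (\<lambda>i. (?u i)\<^sup>2) - ?U\<^sup>2))"
      unfolding * using True by (simp add: f_coef_def mult_ac)
    also have "\<dots> \<longleftrightarrow> (real n - 1) * ?U\<^sup>2 \<le> z\<^sup>2 * (sample_mean n (\<lambda>i. (?u i)\<^sup>2) - ?U\<^sup>2)"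
      using n by (intro mult_le_cancel_left_pos) simp
    also have "\<dots> \<longleftrightarrow> (real n - 1 + z\<^sup>2) * ?U\<^sup>2 \<le> z\<^sup>2 * sample_mean n (\<lambda>i. (?u i)\<^sup>2)"
      by (simp add: algebra_simps)
    also have "(real n - 1 + z\<^sup>2) * ?U\<^sup>2 = studentizer_weight k z n * (real n * ?U\<^sup>2)"
      using n True by (simp add: studentizer_weight_def)
    finally show ?thesis .
  next
    case False
    have "?a i - \<beta> * ?b i = ?u i" for i
      using False by (simp add: residual_def g_yy_def g_xy_def)
    then have "f_coef k n * ?U\<^sup>2 \<le> z\<^sup>2 * (\<Sum>i=1..n. (?a i - \<beta> * ?b i)\<^sup>2) \<longleftrightarrow>
       real n * (real n * ?U\<^sup>2) \<le> real n * (z\<^sup>2 * sample_mean n (\<lambda>i. (?u i)\<^sup>2))"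
      using False n by (simp add: f_coef_def sample_mean_def power2_eq_square mult_ac)
    then show ?thesis using n False by (simp add: studentizer_weight_def)
  qed
  finally show ?thesis .
qed

text \<open>With \<open>c = 1\<close> the products are invariant under translations of the data, with \<open>c = 0\<close> the translations
  are void. This allows centring the explanatory variables and removing the intercept.\<close>

lemma s_term_shift:
  assumes c: "c * c = c" and "n \<ge> 1"
    and u: "\<And>j. j \<in> {1..n} \<Longrightarrow> u j = u' j + c * a" and v: "\<And>j. j \<in> {1..n} \<Longrightarrow> v j = v' j + c * b"
    and i: "i \<in> {1..n}"
  shows "s_term c n u v i = s_term c n u' v' i"
proof -
  have m: "c * sample_mean n f = c * sample_mean n f' + c * t"
    if "\<And>j. j \<in> {1..n} \<Longrightarrow> f j = f' j + c * t" for f f' t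
  proof -
    have "sample_mean n f = sample_mean n f' + c * t"
      using sample_mean_cong[of n f "\<lambda>j. f' j + c * t", OF that] \<open>n \<ge> 1\<close>
      by (simp add: sample_mean_add sample_mean_const)
    then show ?thesis using c by (simp add: distrib_left mult.assoc[symmetric])
  qed
  have "c * sample_mean n u = c * sample_mean n u' + c * a"
    by (rule m) (rule u)
  moreover have "c * sample_mean n v = c * sample_mean n v' + c * b"
    by (rule m) (rule v)
  ultimately show ?thesis
    unfolding s_term_def u[OF i] v[OF i] by simp
qed

text \<open>The limits depend on the data through the products only, so that they are not affected by the
  translations above.\<close>

lemma confidence_limits_cong:
  assumes yy: "\<And>i. i \<in> {1..n} \<Longrightarrow> s_term c n y y i = s_term c n y' y' i"
    and xy: "\<And>i. i \<in> {1..n} \<Longrightarrow> s_term c n x y i = s_term c n x' y' i"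
  shows "limits_defined k c v \<mu> z n x y \<longleftrightarrow> limits_defined k c v \<mu> z n x' y'"
    and "B_limit k l c v \<mu> z n x y = B_limit k l c v \<mu> z n x' y'"
proof -
  have S: "S_stat c n y y = S_stat c n y' y'" "S_stat c n x y = S_stat c n x' y'"
    unfolding S_stat_def by (intro sample_mean_cong yy xy, assumption)+
  have g: "g_yy k c v n y = g_yy k c v n y'" "g_xy k c \<mu> n x y = g_xy k c \<mu> n x' y'"
    "beta_hat c v \<mu> n x y = beta_hat c v \<mu> n x' y'"
    "beta_hat_defined c v \<mu> n x y = beta_hat_defined c v \<mu> n x' y'"
    by (simp_all add: g_yy_def g_xy_def beta_hat_def beta_hat_defined_def S)
  have D: "D_stat k c v \<mu> z n x y = D_stat k c v \<mu> z n x' y'"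
    unfolding D_stat_def S g by (simp add: yy xy cong: sum.cong_simp del: One_nat_def)
  have P: "B_denom k c \<mu> z n x y = B_denom k c \<mu> z n x' y'"
    unfolding B_denom_def S g by (simp add: xy cong: sum.cong_simp del: One_nat_def)
  show "limits_defined k c v \<mu> z n x y \<longleftrightarrow> limits_defined k c v \<mu> z n x' y'"
    by (simp add: limits_defined_def g D P)
  show "B_limit k l c v \<mu> z n x y = B_limit k l c v \<mu> z n x' y'"
    unfolding B_limit_def S g D P by (simp add: yy xy cong: sum.cong_simp del: One_nat_def)
qed

section \<open>Coverage probability for independent identically distributed pairs\<close>

lemma abs_mult_le_sum_squares: "\<bar>s * t\<bar> \<le> s\<^sup>2 + t\<^sup>2" for s t :: real
proof -
  have "0 \<le> (\<bar>s\<bar> - \<bar>t\<bar>)\<^sup>2" by simp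
  then have "2 * (\<bar>s\<bar> * \<bar>t\<bar>) \<le> s\<^sup>2 + t\<^sup>2" by (simp add: power2_diff)
  moreover have "0 \<le> \<bar>s\<bar> * \<bar>t\<bar>" by simp
  ultimately show ?thesis unfolding abs_mult by linarith
qed

lemma integrable_mult_of_squares:
  fixes f g :: "'a \<Rightarrow> real"
  assumes [measurable]: "f \<in> borel_measurable M" "g \<in> borel_measurable M"
    and "integrable M (\<lambda>\<omega>. (f \<omega>)\<^sup>2)" "integrable M (\<lambda>\<omega>. (g \<omega>)\<^sup>2)"
  shows "integrable M (\<lambda>\<omega>. f \<omega> * g \<omega>)"
proof (rule Bochner_Integration.integrable_bound)
  show "integrable M (\<lambda>\<omega>. (f \<omega>)\<^sup>2 + (g \<omega>)\<^sup>2)" using assms by simp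
  show "AE \<omega> in M. norm (f \<omega> * g \<omega>) \<le> norm ((f \<omega>)\<^sup>2 + (g \<omega>)\<^sup>2)"
    using abs_mult_le_sum_squares by simp
qed measurable

lemma s_term_measurable [measurable (raw)]:
  "(\<And>i. X i \<in> borel_measurable M) \<Longrightarrow> (\<And>i. Y i \<in> borel_measurable M) \<Longrightarrow>
     (\<lambda>\<omega>. s_term c n (\<lambda>i. X i \<omega>) (\<lambda>i. Y i \<omega>) j) \<in> borel_measurable M"
  unfolding s_term_def sample_mean_def
  by (intro borel_measurable_times borel_measurable_diff borel_measurable_divide borel_measurable_sum
      borel_measurable_const) simp_all

lemma S_stat_measurable [measurable (raw)]:
  assumes "\<And>i. X i \<in> borel_measurable M" "\<And>i. Y i \<in> borel_measurable M"
  shows "(\<lambda>\<omega>. S_stat c n (\<lambda>i. X i \<omega>) (\<lambda>i. Y i \<omega>)) \<in> borel_measurable M"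
  unfolding S_stat_def sample_mean_def
  by (intro borel_measurable_divide borel_measurable_sum borel_measurable_const s_term_measurable assms)

lemma confidence_limits_measurable:
  assumes [measurable]: "\<And>i. X i \<in> borel_measurable M" "\<And>i. Y i \<in> borel_measurable M"
  shows "(\<lambda>\<omega>. beta_hat c v \<mu> n (\<lambda>i. X i \<omega>) (\<lambda>i. Y i \<omega>)) \<in> borel_measurable M" (is ?beta)
    and "Measurable.pred M (\<lambda>\<omega>. beta_hat_defined c v \<mu> n (\<lambda>i. X i \<omega>) (\<lambda>i. Y i \<omega>))" (is ?def)
    and "(\<lambda>\<omega>. D_stat k c v \<mu> z n (\<lambda>i. X i \<omega>) (\<lambda>i. Y i \<omega>)) \<in> borel_measurable M" (is ?D)
    and "(\<lambda>\<omega>. B_denom k c \<mu> z n (\<lambda>i. X i \<omega>) (\<lambda>i. Y i \<omega>)) \<in> borel_measurable M" (is ?P)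
    and "(\<lambda>\<omega>. B_limit k l c v \<mu> z n (\<lambda>i. X i \<omega>) (\<lambda>i. Y i \<omega>)) \<in> borel_measurable M" (is ?B)
    and "Measurable.pred M (\<lambda>\<omega>. limits_defined k c v \<mu> z n (\<lambda>i. X i \<omega>) (\<lambda>i. Y i \<omega>))" (is ?L)
proof -
  show beta[measurable]: ?beta unfolding beta_hat_def by measurable
  show def[measurable]: ?def unfolding beta_hat_defined_def by measurable
  have [measurable]: "(\<lambda>\<omega>. g_yy k c v n (\<lambda>i. Y i \<omega>)) \<in> borel_measurable M"
    unfolding g_yy_def by measurable
  have [measurable]: "(\<lambda>\<omega>. g_xy k c \<mu> n (\<lambda>i. X i \<omega>) (\<lambda>i. Y i \<omega>)) \<in> borel_measurable M"
    unfolding g_xy_def by measurable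
  show D[measurable]: ?D unfolding D_stat_def by measurable
  show P[measurable]: ?P unfolding B_denom_def by measurable
  show B: ?B unfolding B_limit_def by measurable
  show L: ?L unfolding limits_defined_def by measurable
qed

context prob_space
begin

text \<open>Here \<open>W\<close> and \<open>X\<close> stand for the observations \<open>y\<close> and \<open>x\<close> after centring; the model enters through
  moment conditions only. Replacing \<open>W i\<close> and \<open>X i\<close> by
  their deviations from the sample means \<open>p\<close> and \<open>q\<close> changes \<open>residual i\<close> from \<open>V i\<close> to
  \<open>V i - p * \<eta> i - r * W i + p * r\<close> with \<open>r = p - \<beta> * q\<close>. The sample mean of the residuals is then
  that of \<open>V\<close> minus \<open>p * r\<close>, a product of two centred means, and their mean square has the same
  limit as that of \<open>V\<close>.\<close>

theorem interval_coverage: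
  fixes W X :: "nat \<Rightarrow> 'a \<Rightarrow> real" and c v \<mu> \<beta> z :: real
  defines "\<eta> \<equiv> \<lambda>i \<omega>. W i \<omega> - \<beta> * X i \<omega>"
  defines "V \<equiv> \<lambda>i \<omega>. W i \<omega> * \<eta> i \<omega> - (v - \<beta> * \<mu>)"
  assumes iid: "iid (borel \<Otimes>\<^sub>M borel) (\<lambda>i \<omega>. (W i \<omega>, X i \<omega>))"
    and c: "c * c = c"
    and centred: "c * expectation (W 0) = 0" "c * expectation (X 0) = 0"
    and W2: "integrable M (\<lambda>\<omega>. (W 0 \<omega>)\<^sup>2)" and X2: "integrable M (\<lambda>\<omega>. (X 0 \<omega>)\<^sup>2)"
    and V2: "integrable M (\<lambda>\<omega>. (V 0 \<omega>)\<^sup>2)" and V2_pos: "expectation (\<lambda>\<omega>. (V 0 \<omega>)\<^sup>2) > 0"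
    and V_mean: "expectation (V 0) = 0"
    and yy: "expectation (\<lambda>\<omega>. (W 0 \<omega>)\<^sup>2) > v"
    and xy: "expectation (\<lambda>\<omega>. W 0 \<omega> * X 0 \<omega>) \<noteq> \<mu>"
    and z: "z > 0"
  shows "(\<lambda>n. prob {\<omega>\<in>space M.
            limits_defined k c v \<mu> z n (\<lambda>i. X i \<omega>) (\<lambda>i. W i \<omega>) \<and>
            \<beta> \<in> {B_limit k 1 c v \<mu> z n (\<lambda>i. X i \<omega>) (\<lambda>i. W i \<omega>) ..
                  B_limit k 2 c v \<mu> z n (\<lambda>i. X i \<omega>) (\<lambda>i. W i \<omega>)}})
          \<longlonglongrightarrow> 2 * cdf std_normal_distribution z - 1"
proof -
  have pair_fun: "iid borel (\<lambda>i \<omega>. g (W i \<omega>) (X i \<omega>))" if [measurable]: "case_prod g \<in> borel_measurable (borel \<Otimes>\<^sub>M borel)"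
    for g :: "real \<Rightarrow> real \<Rightarrow> real"
    using iid_compose[OF iid that] by simp
  have iids: "iid borel W" "iid borel X" "iid borel \<eta>" "iid borel V"
    unfolding \<eta>_def V_def by (rule pair_fun; measurable)+
  note [measurable] = iids[THEN iid_measurable]
  have "(\<lambda>\<omega>. (\<eta> 0 \<omega>)\<^sup>2) = (\<lambda>\<omega>. (W 0 \<omega>)\<^sup>2 + \<beta>\<^sup>2 * (X 0 \<omega>)\<^sup>2 - 2 * \<beta> * (W 0 \<omega> * X 0 \<omega>))"
    by (simp add: \<eta>_def power2_diff power_mult_distrib fun_eq_iff)
  moreover have WX: "integrable M (\<lambda>\<omega>. W 0 \<omega> * X 0 \<omega>)"
    by (rule integrable_mult_of_squares) (use W2 X2 in simp_all)
  ultimately have \<eta>2: "integrable M (\<lambda>\<omega>. (\<eta> 0 \<omega>)\<^sup>2)"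
    using W2 X2 by simp
  have int1: "integrable M (W 0)" "integrable M (X 0)" "integrable M (\<eta> 0)" "integrable M (V 0)"
    by (rule square_integrable_imp_integrable; use W2 X2 \<eta>2 V2 in simp)+
  have int2: "integrable M (\<lambda>\<omega>. \<eta> 0 \<omega> * W 0 \<omega>)" "integrable M (\<lambda>\<omega>. V 0 \<omega> * W 0 \<omega>)" "integrable M (\<lambda>\<omega>. V 0 \<omega> * \<eta> 0 \<omega>)"
    by (rule integrable_mult_of_squares; use W2 \<eta>2 V2 in simp)+
  have iid2: "iid borel (\<lambda>i \<omega>. (W i \<omega>)\<^sup>2)" "iid borel (\<lambda>i \<omega>. (X i \<omega>)\<^sup>2)" "iid borel (\<lambda>i \<omega>. (\<eta> i \<omega>)\<^sup>2)"
      "iid borel (\<lambda>i \<omega>. (V i \<omega>)\<^sup>2)" "iid borel (\<lambda>i \<omega>. W i \<omega> * X i \<omega>)" "iid borel (\<lambda>i \<omega>. \<eta> i \<omega> * W i \<omega>)"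
      "iid borel (\<lambda>i \<omega>. V i \<omega> * W i \<omega>)" "iid borel (\<lambda>i \<omega>. V i \<omega> * \<eta> i \<omega>)"
    unfolding \<eta>_def V_def by (rule pair_fun; measurable)+
  note lln1 = weak_law_of_large_numbers[OF iids(1) int1(1)] weak_law_of_large_numbers[OF iids(2) int1(2)]
    weak_law_of_large_numbers[OF iids(3) int1(3)] weak_law_of_large_numbers[OF iids(4) int1(4)]
  note lln2 = weak_law_of_large_numbers[OF iid2(1) W2] weak_law_of_large_numbers[OF iid2(2) X2]
    weak_law_of_large_numbers[OF iid2(3) \<eta>2] weak_law_of_large_numbers[OF iid2(4) V2]
    weak_law_of_large_numbers[OF iid2(5) WX] weak_law_of_large_numbers[OF iid2(6) int2(1)]
    weak_law_of_large_numbers[OF iid2(7) int2(2)] weak_law_of_large_numbers[OF iid2(8) int2(3)]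
  define p where "p = (\<lambda>n \<omega>. c * sample_mean n (\<lambda>i. W i \<omega>))"
  define q where "q = (\<lambda>n \<omega>. c * sample_mean n (\<lambda>i. X i \<omega>))"
  define r where "r = (\<lambda>n \<omega>. c * sample_mean n (\<lambda>i. \<eta> i \<omega>))"
  have r_pq: "r n \<omega> = p n \<omega> - \<beta> * q n \<omega>" for n \<omega>
    by (simp add: p_def q_def r_def \<eta>_def sample_mean_diff sample_mean_cmult algebra_simps)
  have p0: "tendsto_prob p 0" and q0: "tendsto_prob q 0"
    unfolding p_def q_def
    using tendsto_prob_mult[OF tendsto_prob_const[OF tendsto_const[of c]] lln1(1)]
      tendsto_prob_mult[OF tendsto_prob_const[OF tendsto_const[of c]] lln1(2)] centred by simp_all
  have r0: "tendsto_prob r 0"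
    using tendsto_prob_diff[OF p0 tendsto_prob_mult[OF tendsto_prob_const[OF tendsto_const[of \<beta>]] q0]]
    by (simp add: r_pq[abs_def])
  note [measurable] = p0[THEN tendsto_prob_measurable] q0[THEN tendsto_prob_measurable]
    r0[THEN tendsto_prob_measurable]
  note tp = tendsto_prob_add tendsto_prob_diff tendsto_prob_mult tendsto_prob_power2
    tendsto_prob_const[OF tendsto_const] p0 q0 r0 lln1 lln2

  define Syy where "Syy = (\<lambda>n \<omega>. S_stat c n (\<lambda>i. W i \<omega>) (\<lambda>i. W i \<omega>))"
  define Sxy where "Sxy = (\<lambda>n \<omega>. S_stat c n (\<lambda>i. X i \<omega>) (\<lambda>i. W i \<omega>))"
  have [measurable]: "Syy n \<in> borel_measurable M" "Sxy n \<in> borel_measurable M" for n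
    unfolding Syy_def Sxy_def by measurable
  have syy: "s_term c n (\<lambda>i. W i \<omega>) (\<lambda>i. W i \<omega>) i = (W i \<omega> - p n \<omega>)\<^sup>2" for n i \<omega>
    by (simp add: s_term_def p_def power2_eq_square)
  have sxy: "s_term c n (\<lambda>i. X i \<omega>) (\<lambda>i. W i \<omega>) i = W i \<omega> * X i \<omega> - p n \<omega> * X i \<omega> - q n \<omega> * W i \<omega> + p n \<omega> * q n \<omega>" for n i \<omega>
    by (simp add: s_term_def p_def q_def algebra_simps)
  have "tendsto_prob Syy (expectation (\<lambda>\<omega>. (W 0 \<omega>)\<^sup>2) - 2 * 0 * expectation (W 0) + 0\<^sup>2)"
  proof (rule tendsto_prob_eventually_cong)
    show "tendsto_prob (\<lambda>n \<omega>. sample_mean n (\<lambda>i. (W i \<omega>)\<^sup>2) - 2 * p n \<omega> * sample_mean n (\<lambda>i. W i \<omega>) + (p n \<omega>)\<^sup>2)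
      (expectation (\<lambda>\<omega>. (W 0 \<omega>)\<^sup>2) - 2 * 0 * expectation (W 0) + 0\<^sup>2)"
      by (intro tp)
    have "Syy n \<omega> = sample_mean n (\<lambda>i. (W i \<omega>)\<^sup>2 - 2 * p n \<omega> * W i \<omega> + (p n \<omega>)\<^sup>2)" for n \<omega>
      unfolding Syy_def S_stat_def syy[abs_def] by (simp add: power2_diff algebra_simps)
    then show "\<forall>\<^sub>F n in sequentially. \<forall>\<omega>\<in>space M.
      sample_mean n (\<lambda>i. (W i \<omega>)\<^sup>2) - 2 * p n \<omega> * sample_mean n (\<lambda>i. W i \<omega>) + (p n \<omega>)\<^sup>2 = Syy n \<omega>"
      by (intro eventually_sequentiallyI[of 1])
         (simp add: sample_mean_add sample_mean_diff sample_mean_cmult sample_mean_const)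
  qed simp
  then have Syy: "tendsto_prob Syy (expectation (\<lambda>\<omega>. (W 0 \<omega>)\<^sup>2))" by simp
  have "tendsto_prob Sxy (expectation (\<lambda>\<omega>. W 0 \<omega> * X 0 \<omega>) - 0 * expectation (X 0) - 0 * expectation (W 0) + 0 * 0)"
  proof (rule tendsto_prob_eventually_cong)
    show "tendsto_prob (\<lambda>n \<omega>. sample_mean n (\<lambda>i. W i \<omega> * X i \<omega>) - p n \<omega> * sample_mean n (\<lambda>i. X i \<omega>)
        - q n \<omega> * sample_mean n (\<lambda>i. W i \<omega>) + p n \<omega> * q n \<omega>)
      (expectation (\<lambda>\<omega>. W 0 \<omega> * X 0 \<omega>) - 0 * expectation (X 0) - 0 * expectation (W 0) + 0 * 0)"
      by (intro tp)
    show "\<forall>\<^sub>F n in sequentially. \<forall>\<omega>\<in>space M. sample_mean n (\<lambda>i. W i \<omega> * X i \<omega>) - p n \<omega> * sample_mean n (\<lambda>i. X i \<omega>)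
        - q n \<omega> * sample_mean n (\<lambda>i. W i \<omega>) + p n \<omega> * q n \<omega> = Sxy n \<omega>"
      unfolding Sxy_def S_stat_def sxy[abs_def]
      by (intro eventually_sequentiallyI[of 1])
         (simp add: sample_mean_add sample_mean_diff sample_mean_cmult sample_mean_const)
  qed simp
  then have Sxy: "tendsto_prob Sxy (expectation (\<lambda>\<omega>. W 0 \<omega> * X 0 \<omega>))" by simp

  define P where "P = (\<lambda>n \<omega>. B_denom k c \<mu> z n (\<lambda>i. X i \<omega>) (\<lambda>i. W i \<omega>))"
  have [measurable]: "P n \<in> borel_measurable M" for n
    unfolding P_def by (rule confidence_limits_measurable) simp_all
  define g where "g = (\<lambda>n \<omega>. g_xy k c \<mu> n (\<lambda>i. X i \<omega>) (\<lambda>i. W i \<omega>))"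
  have g: "tendsto_prob g (if k = 1 then expectation (\<lambda>\<omega>. W 0 \<omega> * X 0 \<omega>) else \<mu>)"
    using Sxy tendsto_prob_const[OF tendsto_const[of \<mu>]] by (simp add: g_def g_xy_def Sxy_def)
  note [measurable] = g[THEN tendsto_prob_measurable]
  have inv: "tendsto_prob (\<lambda>n \<omega>. 1 / real n) 0"
    by (rule tendsto_prob_const[OF lim_1_over_n])
  \<comment> \<open>the part subtracted in the denominator: its main term has squares of \<open>W i * X i\<close>, which is only integrable\<close>
  have noise: "tendsto_prob (\<lambda>n \<omega>. sample_mean n (\<lambda>i. (s_term c n (\<lambda>i. X i \<omega>) (\<lambda>i. W i \<omega>) i - g n \<omega>)\<^sup>2) / real n) 0"
    (is "tendsto_prob ?noise 0")
  proof (rule tendsto_prob_0_squeeze)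
    let ?bound = "\<lambda>n \<omega>. 5 * (sample_mean n (\<lambda>i. (W i \<omega> * X i \<omega>)\<^sup>2) / real n
        + ((p n \<omega>)\<^sup>2 * sample_mean n (\<lambda>i. (X i \<omega>)\<^sup>2) + (q n \<omega>)\<^sup>2 * sample_mean n (\<lambda>i. (W i \<omega>)\<^sup>2)
           + (p n \<omega> * q n \<omega>)\<^sup>2 + (g n \<omega>)\<^sup>2) * (1 / real n))"
    have "tendsto_prob ?bound (5 * (0 + (0\<^sup>2 * expectation (\<lambda>\<omega>. (X 0 \<omega>)\<^sup>2) + 0\<^sup>2 * expectation (\<lambda>\<omega>. (W 0 \<omega>)\<^sup>2)
           + (0 * 0)\<^sup>2 + (if k = 1 then expectation (\<lambda>\<omega>. W 0 \<omega> * X 0 \<omega>) else \<mu>)\<^sup>2) * 0))"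
      by (intro tp g inv tendsto_prob_sum_squares[OF iid2(5) WX])
    then show "tendsto_prob ?bound 0" by simp
    show "?noise n \<in> borel_measurable M" for n by measurable
    show "\<bar>?noise n \<omega>\<bar> \<le> ?bound n \<omega>" for n \<omega>
    proof (cases "n \<ge> 1")
      case False
      then show ?thesis by (simp add: sample_mean_def)
    next
      case True
      have five: "(a1 - a2 - a3 + a4 - a5)\<^sup>2 \<le> 5 * (a1\<^sup>2 + a2\<^sup>2 + a3\<^sup>2 + a4\<^sup>2 + a5\<^sup>2)" for a1 a2 a3 a4 a5 :: real
      proof -
        have "5 * (a1\<^sup>2 + a2\<^sup>2 + a3\<^sup>2 + a4\<^sup>2 + a5\<^sup>2) - (a1 - a2 - a3 + a4 - a5)\<^sup>2
          = (a1 + a2)\<^sup>2 + (a1 + a3)\<^sup>2 + (a1 - a4)\<^sup>2 + (a1 + a5)\<^sup>2 + (a2 - a3)\<^sup>2 + (a2 + a4)\<^sup>2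
            + (a2 - a5)\<^sup>2 + (a3 + a4)\<^sup>2 + (a3 - a5)\<^sup>2 + (a4 + a5)\<^sup>2"
          by algebra
        also have "\<dots> \<ge> 0" by (intro add_nonneg_nonneg zero_le_power2)
        finally show ?thesis by simp
      qed
      have "sample_mean n (\<lambda>i. (s_term c n (\<lambda>i. X i \<omega>) (\<lambda>i. W i \<omega>) i - g n \<omega>)\<^sup>2)
        \<le> sample_mean n (\<lambda>i. 5 * ((W i \<omega> * X i \<omega>)\<^sup>2 + (p n \<omega>)\<^sup>2 * (X i \<omega>)\<^sup>2 + (q n \<omega>)\<^sup>2 * (W i \<omega>)\<^sup>2
             + (p n \<omega> * q n \<omega>)\<^sup>2 + (g n \<omega>)\<^sup>2))"
        unfolding sxy using five by (intro sample_mean_mono) (simp add: power_mult_distrib[symmetric])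
      also have "\<dots> = 5 * (sample_mean n (\<lambda>i. (W i \<omega> * X i \<omega>)\<^sup>2)
        + ((p n \<omega>)\<^sup>2 * sample_mean n (\<lambda>i. (X i \<omega>)\<^sup>2) + (q n \<omega>)\<^sup>2 * sample_mean n (\<lambda>i. (W i \<omega>)\<^sup>2)
           + (p n \<omega> * q n \<omega>)\<^sup>2 + (g n \<omega>)\<^sup>2))"
        using True by (simp only: sample_mean_add sample_mean_cmult sample_mean_const add.assoc)
      finally have "?noise n \<omega> \<le> ?bound n \<omega>"
        using True by (simp add: field_simps)
      moreover have "0 \<le> ?noise n \<omega>"
        by (simp add: sample_mean_def sum_nonneg)
      ultimately show ?thesis by simp
    qed
  qed
  have "tendsto_prob (\<lambda>n \<omega>. P n \<omega> / (real n)\<^sup>2)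
      (1 * (expectation (\<lambda>\<omega>. W 0 \<omega> * X 0 \<omega>) - \<mu>)\<^sup>2 - z\<^sup>2 * 0)"
  proof (rule tendsto_prob_eventually_cong)
    have "(\<lambda>n. 1 - 1 / real n) \<longlonglongrightarrow> 1 - 0"
      by (intro tendsto_diff tendsto_const lim_1_over_n)
    then have f: "(\<lambda>n. if k = 1 then 1 - 1 / real n else 1) \<longlonglongrightarrow> 1" by (cases "k = 1") auto
    show "tendsto_prob (\<lambda>n \<omega>. (if k = 1 then 1 - 1 / real n else 1) * (Sxy n \<omega> - \<mu>)\<^sup>2 - z\<^sup>2 * ?noise n \<omega>)
      (1 * (expectation (\<lambda>\<omega>. W 0 \<omega> * X 0 \<omega>) - \<mu>)\<^sup>2 - z\<^sup>2 * 0)"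
      by (intro tendsto_prob_diff tendsto_prob_mult tendsto_prob_power2 Sxy noise tendsto_prob_const f tendsto_const)
    show "\<forall>\<^sub>F n in sequentially. \<forall>\<omega>\<in>space M.
       (if k = 1 then 1 - 1 / real n else 1) * (Sxy n \<omega> - \<mu>)\<^sup>2 - z\<^sup>2 * ?noise n \<omega> = P n \<omega> / (real n)\<^sup>2"
    proof (intro eventually_sequentiallyI[of 1] ballI)
      fix n :: nat and \<omega> assume n: "1 \<le> n"
      have "f_coef k n / (real n)\<^sup>2 = (if k = 1 then 1 - 1 / real n else 1)"
        using n by (simp add: f_coef_def field_simps power2_eq_square)
      moreover have "P n \<omega> / (real n)\<^sup>2 = f_coef k n / (real n)\<^sup>2 * (Sxy n \<omega> - \<mu>)\<^sup>2 - z\<^sup>2 * ?noise n \<omega>"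
        by (simp add: P_def B_denom_def Sxy_def g_def sample_mean_def diff_divide_distrib power2_eq_square)
      ultimately show "(if k = 1 then 1 - 1 / real n else 1) * (Sxy n \<omega> - \<mu>)\<^sup>2 - z\<^sup>2 * ?noise n \<omega> = P n \<omega> / (real n)\<^sup>2"
        by simp
    qed
  qed measurable
  then have P: "tendsto_prob (\<lambda>n \<omega>. P n \<omega> / (real n)\<^sup>2) ((expectation (\<lambda>\<omega>. W 0 \<omega> * X 0 \<omega>) - \<mu>)\<^sup>2)" by simp

  define \<sigma> where "\<sigma> = sqrt (expectation (\<lambda>\<omega>. (V 0 \<omega>)\<^sup>2))"
  have \<sigma>: "\<sigma> > 0" "\<sigma>\<^sup>2 = expectation (\<lambda>\<omega>. (V 0 \<omega>)\<^sup>2)" using V2_pos by (auto simp: \<sigma>_def)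
  define Z where "Z = (\<lambda>n \<omega>. (\<Sum>i=1..n. V i \<omega>) / sqrt (real n * \<sigma>\<^sup>2))"
  have [measurable]: "Z n \<in> borel_measurable M" for n unfolding Z_def by measurable
  have "variance (V 0) = \<sigma>\<^sup>2" by (simp add: V_mean \<sigma>)
  then have clt: "weak_conv_m (\<lambda>n. distr M borel (Z n)) std_normal_distribution"
    using iid_central_limit[OF iids(4) V2 _ \<sigma>(1)] by (simp add: V_mean Z_def)

  define R where "R = (\<lambda>n \<omega>. sqrt (real n) * (p n \<omega> * r n \<omega>) / \<sigma>)"
  have R: "tendsto_prob R 0"
  proof (rule tendsto_prob_0_squeeze)
    have cW: "iid borel (\<lambda>i \<omega>. c * W i \<omega>)" and c\<eta>: "iid borel (\<lambda>i \<omega>. c * \<eta> i \<omega>)"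
      unfolding \<eta>_def by (rule pair_fun; measurable)+
    have c\<eta>_mean: "c * expectation (\<eta> 0) = 0"
      using int1 centred by (auto simp: \<eta>_def)
    have "tendsto_prob (\<lambda>n \<omega>. sqrt (real n) * (sample_mean n (\<lambda>i. c * W i \<omega>))\<^sup>2) 0"
      by (rule tendsto_prob_sqrt_times_mean_square[OF cW]) (use W2 centred in \<open>simp_all add: power_mult_distrib\<close>)
    moreover have "tendsto_prob (\<lambda>n \<omega>. sqrt (real n) * (sample_mean n (\<lambda>i. c * \<eta> i \<omega>))\<^sup>2) 0"
      by (rule tendsto_prob_sqrt_times_mean_square[OF c\<eta>]) (use \<eta>2 c\<eta>_mean in \<open>simp_all add: power_mult_distrib\<close>)
    ultimately have "tendsto_prob (\<lambda>n \<omega>. (1 / \<sigma>) * (sqrt (real n) * (p n \<omega>)\<^sup>2 + sqrt (real n) * (r n \<omega>)\<^sup>2)) ((1 / \<sigma>) * (0 + 0))"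
      unfolding sample_mean_cmult p_def r_def by (intro tp)
    then show "tendsto_prob (\<lambda>n \<omega>. (1 / \<sigma>) * (sqrt (real n) * (p n \<omega>)\<^sup>2 + sqrt (real n) * (r n \<omega>)\<^sup>2)) 0" by simp
    show "R n \<in> borel_measurable M" for n unfolding R_def by measurable
    show "\<bar>R n \<omega>\<bar> \<le> (1 / \<sigma>) * (sqrt (real n) * (p n \<omega>)\<^sup>2 + sqrt (real n) * (r n \<omega>)\<^sup>2)" for n \<omega>
    proof -
      from abs_mult_le_sum_squares[of "p n \<omega>" "r n \<omega>"]
      have "sqrt (real n) / \<sigma> * \<bar>p n \<omega> * r n \<omega>\<bar> \<le> sqrt (real n) / \<sigma> * ((p n \<omega>)\<^sup>2 + (r n \<omega>)\<^sup>2)"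
        using \<sigma> by (intro mult_left_mono) auto
      then show ?thesis using \<sigma> by (simp add: R_def abs_mult field_simps)
    qed
  qed

  define u where "u = (\<lambda>n \<omega>. residual c v \<mu> \<beta> n (\<lambda>i. X i \<omega>) (\<lambda>i. W i \<omega>))"
  have u: "u n \<omega> i = V i \<omega> - p n \<omega> * \<eta> i \<omega> - r n \<omega> * W i \<omega> + p n \<omega> * r n \<omega>" for n \<omega> i
    unfolding u_def residual_def syy sxy r_pq
    by (simp add: V_def \<eta>_def power2_eq_square algebra_simps)
  have mean_u: "sample_mean n (u n \<omega>) = sample_mean n (\<lambda>i. V i \<omega>) - p n \<omega> * r n \<omega>" if "n \<ge> 1" for n \<omega>
  proof -
    have eqs: "p n \<omega> * sample_mean n (\<lambda>i. \<eta> i \<omega>) = p n \<omega> * r n \<omega>"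
        "r n \<omega> * sample_mean n (\<lambda>i. W i \<omega>) = p n \<omega> * r n \<omega>"
      unfolding p_def r_def by (simp_all add: mult_ac c mult.assoc[of c c, symmetric])
    show ?thesis
      unfolding u[abs_def] sample_mean_add sample_mean_diff sample_mean_cmult sample_mean_const[OF that] eqs
      by simp
  qed
  define Q where "Q = (\<lambda>n \<omega>. sample_mean n (\<lambda>i. (u n \<omega> i)\<^sup>2))"
  have [measurable]: "Q n \<in> borel_measurable M" for n unfolding Q_def u by measurable
  have "tendsto_prob Q (expectation (\<lambda>\<omega>. (V 0 \<omega>)\<^sup>2) + 0\<^sup>2 * expectation (\<lambda>\<omega>. (\<eta> 0 \<omega>)\<^sup>2) + 0\<^sup>2 * expectation (\<lambda>\<omega>. (W 0 \<omega>)\<^sup>2)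
      - 2 * 0 * expectation (\<lambda>\<omega>. V 0 \<omega> * \<eta> 0 \<omega>) - 2 * 0 * expectation (\<lambda>\<omega>. V 0 \<omega> * W 0 \<omega>)
      + 2 * (0 * 0) * expectation (V 0) + 2 * (0 * 0) * expectation (\<lambda>\<omega>. \<eta> 0 \<omega> * W 0 \<omega>)
      - 2 * (0\<^sup>2 * 0) * expectation (\<eta> 0) - 2 * (0 * 0\<^sup>2) * expectation (W 0) + (0 * 0)\<^sup>2)"
  proof (rule tendsto_prob_eventually_cong)
    let ?Q = "\<lambda>n \<omega>. sample_mean n (\<lambda>i. (V i \<omega>)\<^sup>2) + (p n \<omega>)\<^sup>2 * sample_mean n (\<lambda>i. (\<eta> i \<omega>)\<^sup>2)
      + (r n \<omega>)\<^sup>2 * sample_mean n (\<lambda>i. (W i \<omega>)\<^sup>2)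
      - 2 * p n \<omega> * sample_mean n (\<lambda>i. V i \<omega> * \<eta> i \<omega>) - 2 * r n \<omega> * sample_mean n (\<lambda>i. V i \<omega> * W i \<omega>)
      + 2 * (p n \<omega> * r n \<omega>) * sample_mean n (\<lambda>i. V i \<omega>) + 2 * (p n \<omega> * r n \<omega>) * sample_mean n (\<lambda>i. \<eta> i \<omega> * W i \<omega>)
      - 2 * ((p n \<omega>)\<^sup>2 * r n \<omega>) * sample_mean n (\<lambda>i. \<eta> i \<omega>) - 2 * (p n \<omega> * (r n \<omega>)\<^sup>2) * sample_mean n (\<lambda>i. W i \<omega>)
      + (p n \<omega> * r n \<omega>)\<^sup>2"
    show "tendsto_prob ?Q (expectation (\<lambda>\<omega>. (V 0 \<omega>)\<^sup>2) + 0\<^sup>2 * expectation (\<lambda>\<omega>. (\<eta> 0 \<omega>)\<^sup>2) + 0\<^sup>2 * expectation (\<lambda>\<omega>. (W 0 \<omega>)\<^sup>2)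
      - 2 * 0 * expectation (\<lambda>\<omega>. V 0 \<omega> * \<eta> 0 \<omega>) - 2 * 0 * expectation (\<lambda>\<omega>. V 0 \<omega> * W 0 \<omega>)
      + 2 * (0 * 0) * expectation (V 0) + 2 * (0 * 0) * expectation (\<lambda>\<omega>. \<eta> 0 \<omega> * W 0 \<omega>)
      - 2 * (0\<^sup>2 * 0) * expectation (\<eta> 0) - 2 * (0 * 0\<^sup>2) * expectation (W 0) + (0 * 0)\<^sup>2)"
      by (intro tp)
    have eq: "(u n \<omega> i)\<^sup>2 = (V i \<omega>)\<^sup>2 + (p n \<omega>)\<^sup>2 * (\<eta> i \<omega>)\<^sup>2 + (r n \<omega>)\<^sup>2 * (W i \<omega>)\<^sup>2
      - 2 * p n \<omega> * (V i \<omega> * \<eta> i \<omega>) - 2 * r n \<omega> * (V i \<omega> * W i \<omega>)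
      + 2 * (p n \<omega> * r n \<omega>) * V i \<omega> + 2 * (p n \<omega> * r n \<omega>) * (\<eta> i \<omega> * W i \<omega>)
      - 2 * ((p n \<omega>)\<^sup>2 * r n \<omega>) * \<eta> i \<omega> - 2 * (p n \<omega> * (r n \<omega>)\<^sup>2) * W i \<omega> + (p n \<omega> * r n \<omega>)\<^sup>2" for n \<omega> i
      unfolding u by algebra
    show "\<forall>\<^sub>F n in sequentially. \<forall>\<omega>\<in>space M. ?Q n \<omega> = Q n \<omega>"
      unfolding Q_def eq
      by (intro eventually_sequentiallyI[of 1])
         (simp only: sample_mean_add sample_mean_diff sample_mean_cmult sample_mean_const, simp)
  qed measurable
  then have Q: "tendsto_prob Q (\<sigma>\<^sup>2)" by (simp add: \<sigma>)

  define h where "h = studentizer_weight k z"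
  have h_pos: "h n > 0" if "n \<ge> 1" for n
    using that z by (simp add: h_def studentizer_weight_def add_nonneg_pos)
  have h: "h \<longlonglongrightarrow> 1"
  proof (cases "k = 1")
    case True
    have "(\<lambda>n. 1 + (z\<^sup>2 - 1) * (1 / real n)) \<longlonglongrightarrow> 1 + (z\<^sup>2 - 1) * 0"
      by (intro tendsto_intros lim_1_over_n)
    then have "(\<lambda>n. 1 + (z\<^sup>2 - 1) * (1 / real n)) \<longlonglongrightarrow> 1" by simp
    moreover have "\<forall>\<^sub>F n in sequentially. 1 + (z\<^sup>2 - 1) * (1 / real n) = h n"
      by (intro eventually_sequentiallyI[of 1])
         (simp add: h_def studentizer_weight_def True field_simps)
    ultimately show ?thesis by (rule Lim_transform_eventually)
  next
    case False
    then have "h = (\<lambda>_. 1)" by (simp add: h_def studentizer_weight_def fun_eq_iff)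
    then show ?thesis by simp
  qed
  define K where "K = (\<lambda>n \<omega>. sqrt (Q n \<omega> * (1 / (\<sigma>\<^sup>2 * h n))))"
  have "(\<lambda>n. 1 / (\<sigma>\<^sup>2 * h n)) \<longlonglongrightarrow> 1 / (\<sigma>\<^sup>2 * 1)"
    using \<sigma> by (intro tendsto_intros h) auto
  then have "tendsto_prob K (sqrt (\<sigma>\<^sup>2 * (1 / (\<sigma>\<^sup>2 * 1))))"
    unfolding K_def by (intro tendsto_prob_sqrt tendsto_prob_mult Q tendsto_prob_const)
  then have K: "tendsto_prob K 1" using \<sigma>(1) by simp
  \<comment> \<open>covering means \<open>\<bar>Z - R\<bar> \<le> z * K\<close>, which differs from \<open>\<bar>Z\<bar> \<le> z\<close> by at most this much\<close>
  define err where "err = (\<lambda>n \<omega>. \<bar>R n \<omega>\<bar> + z * \<bar>K n \<omega> - 1\<bar>)"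
  have "tendsto_prob err (\<bar>0\<bar> + z * \<bar>1 - 1\<bar>)"
    unfolding err_def
    by (intro tendsto_prob_add tendsto_prob_mult tendsto_prob_abs tendsto_prob_diff R K tendsto_prob_const tendsto_const)
  then have err: "tendsto_prob err 0" by simp

  define bad where "bad = (\<lambda>n. {\<omega>\<in>space M. Syy n \<omega> - v \<le> 0} \<union> {\<omega>\<in>space M. (Sxy n \<omega> - \<mu>)\<^sup>2 \<le> 0}
     \<union> {\<omega>\<in>space M. P n \<omega> / (real n)\<^sup>2 \<le> 0})"
  have bad: "bad n \<in> events" for n unfolding bad_def by measurable
  have bad_0: "(\<lambda>n. prob (bad n)) \<longlonglongrightarrow> 0"
  proof (rule tendsto_0_of_le)
    show "prob (bad n) \<le> prob {\<omega>\<in>space M. Syy n \<omega> - v \<le> 0} + prob {\<omega>\<in>space M. (Sxy n \<omega> - \<mu>)\<^sup>2 \<le> 0}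
       + prob {\<omega>\<in>space M. P n \<omega> / (real n)\<^sup>2 \<le> 0}" for n
      unfolding bad_def
      by (rule order.trans[OF measure_Un_le add_right_mono[OF measure_Un_le]]) measurable
    show "(\<lambda>n. prob {\<omega>\<in>space M. Syy n \<omega> - v \<le> 0} + prob {\<omega>\<in>space M. (Sxy n \<omega> - \<mu>)\<^sup>2 \<le> 0}
       + prob {\<omega>\<in>space M. P n \<omega> / (real n)\<^sup>2 \<le> 0}) \<longlonglongrightarrow> 0 + 0 + 0"
      using yy xy
      by (intro tendsto_add prob_le_tendsto_0[OF P]
            prob_le_tendsto_0[OF tendsto_prob_diff[OF Syy tendsto_prob_const[OF tendsto_const[of v]]]]
            prob_le_tendsto_0[OF tendsto_prob_power2[OF tendsto_prob_diff[OF Sxy tendsto_prob_const[OF tendsto_const[of \<mu>]]]]])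
         auto
  qed simp_all

  define E where "E = (\<lambda>n. {\<omega>\<in>space M.
            limits_defined k c v \<mu> z n (\<lambda>i. X i \<omega>) (\<lambda>i. W i \<omega>) \<and>
            \<beta> \<in> {B_limit k 1 c v \<mu> z n (\<lambda>i. X i \<omega>) (\<lambda>i. W i \<omega>) ..
                  B_limit k 2 c v \<mu> z n (\<lambda>i. X i \<omega>) (\<lambda>i. W i \<omega>)}})"
  note [measurable] = confidence_limits_measurable(5,6)
  have E: "E n \<in> events" for n unfolding E_def atLeastAtMost_iff by measurable
  have E_iff: "\<omega> \<in> E n \<longleftrightarrow> \<bar>Z n \<omega> - R n \<omega>\<bar> \<le> z * K n \<omega>" if n: "n \<ge> 1" and \<omega>: "\<omega> \<in> space M - bad n" for n \<omega>
  proof -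
    have "P n \<omega> / (real n)\<^sup>2 > 0" "Syy n \<omega> - v > 0" "(Sxy n \<omega> - \<mu>)\<^sup>2 > 0"
      using \<omega> by (auto simp: bad_def not_le)
    then have def: "beta_hat_defined c v \<mu> n (\<lambda>i. X i \<omega>) (\<lambda>i. W i \<omega>)" "P n \<omega> > 0"
      using n by (auto simp: beta_hat_defined_def Sxy_def Syy_def zero_less_divide_iff)
    have "sqrt (real n) * sample_mean n (u n \<omega>) = \<sigma> * (Z n \<omega> - R n \<omega>)"
    proof -
      have "sqrt (real n) * sample_mean n (\<lambda>i. V i \<omega>) = \<sigma> * Z n \<omega>"
        using n \<sigma>(1) by (simp add: sample_mean_def Z_def real_sqrt_mult field_simps)
      moreover have "sqrt (real n) * (p n \<omega> * r n \<omega>) = \<sigma> * R n \<omega>"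
        using \<sigma>(1) by (simp add: R_def)
      ultimately show ?thesis by (simp add: mean_u[OF n] right_diff_distrib)
    qed
    then have "(sqrt (real n) * sample_mean n (u n \<omega>))\<^sup>2 = (\<sigma> * (Z n \<omega> - R n \<omega>))\<^sup>2" by simp
    then have sq: "real n * (sample_mean n (u n \<omega>))\<^sup>2 = \<sigma>\<^sup>2 * (Z n \<omega> - R n \<omega>)\<^sup>2"
      by (simp add: power_mult_distrib)
    have pos: "\<sigma>\<^sup>2 * h n > 0" using \<sigma>(1) h_pos[OF n] by simp
    have Q_nonneg: "Q n \<omega> \<ge> 0" by (simp add: Q_def sample_mean_def sum_nonneg)
    have "\<omega> \<in> E n \<longleftrightarrow> h n * (real n * (sample_mean n (u n \<omega>))\<^sup>2) \<le> z\<^sup>2 * Q n \<omega>"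
      using limits_defined_and_covers_iff[OF n def(1) def(2)[unfolded P_def]] \<omega>
      unfolding E_def h_def u_def Q_def by simp
    also have "\<dots> \<longleftrightarrow> (\<sigma>\<^sup>2 * h n) * (Z n \<omega> - R n \<omega>)\<^sup>2 \<le> (\<sigma>\<^sup>2 * h n) * (z * K n \<omega>)\<^sup>2"
      unfolding sq using pos Q_nonneg by (simp add: K_def power_mult_distrib mult_ac)
    also have "\<dots> \<longleftrightarrow> (Z n \<omega> - R n \<omega>)\<^sup>2 \<le> (z * K n \<omega>)\<^sup>2"
      using pos by (rule mult_le_cancel_left_pos)
    also have "\<dots> \<longleftrightarrow> \<bar>Z n \<omega> - R n \<omega>\<bar> \<le> \<bar>z * K n \<omega>\<bar>" by (rule abs_le_square_iff[symmetric])
    also have "\<bar>z * K n \<omega>\<bar> = z * K n \<omega>" using z Q_nonneg pos by (simp add: K_def)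
    finally show ?thesis .
  qed
  have zK: "z - z * \<bar>K n \<omega> - 1\<bar> \<le> z * K n \<omega> \<and> z * K n \<omega> \<le> z + z * \<bar>K n \<omega> - 1\<bar>" for n \<omega>
  proof -
    have "\<bar>z * K n \<omega> - z\<bar> = z * \<bar>K n \<omega> - 1\<bar>"
      using z by (simp add: abs_mult right_diff_distrib[symmetric, of z _ 1, simplified])
    then show ?thesis by linarith
  qed
  have "(\<lambda>n. prob (E n)) \<longlonglongrightarrow> 2 * cdf std_normal_distribution z - 1"
  proof (rule prob_of_CLT_perturbed[where Z = Z and err = err and bad = bad and ?n0.0 = 1])
    fix n :: nat and \<omega> assume n: "1 \<le> n"
    { assume \<omega>: "\<omega> \<in> space M - bad n" and "\<bar>Z n \<omega>\<bar> \<le> z - err n \<omega>"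
      then have "\<bar>Z n \<omega> - R n \<omega>\<bar> \<le> z * K n \<omega>" using zK[of n \<omega>] unfolding err_def by linarith
      then show "\<omega> \<in> E n" using E_iff[OF n \<omega>] by simp }
    { assume "\<omega> \<in> E n - bad n"
      then have "\<bar>Z n \<omega> - R n \<omega>\<bar> \<le> z * K n \<omega>" using E_iff[OF n, of \<omega>] by (auto simp: E_def)
      then show "\<bar>Z n \<omega>\<bar> \<le> z + err n \<omega>" using zK[of n \<omega>] unfolding err_def by linarith }
  qed (use z clt err E bad bad_0 in simp_all)
  then show ?thesis by (simp add: E_def)
qed

end

section \<open>Independence of the errors and the explanatory variables\<close>

context prob_space
begin

lemma indep_rvD:
  assumes "indep_rv N X L Y" "S \<in> sets N" "T \<in> sets L"
  shows "prob ((X -` S \<inter> space M) \<inter> (Y -` T \<inter> space M)) = prob (X -` S \<inter> space M) * prob (Y -` T \<inter> space M)"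
  using assms unfolding indep_rv_def by (intro indep_setD) auto

lemma indep_rv_compose:
  assumes XY: "indep_rv N X L Y" and f: "f \<in> N \<rightarrow>\<^sub>M N'" and g: "g \<in> L \<rightarrow>\<^sub>M L'"
  shows "indep_rv N' (\<lambda>\<omega>. f (X \<omega>)) L' (\<lambda>\<omega>. g (Y \<omega>))"
proof -
  have [measurable]: "X \<in> M \<rightarrow>\<^sub>M N" "Y \<in> M \<rightarrow>\<^sub>M L" using XY by (auto simp: indep_rv_def)
  note [measurable] = f g
  have vim: "(\<lambda>\<omega>. h (U \<omega>)) -` S \<inter> space M = U -` (h -` S \<inter> space K) \<inter> space M"
    if "U \<in> M \<rightarrow>\<^sub>M K" for h :: "'x \<Rightarrow> 'y" and U S and K :: "'x measure"
    using measurable_space[OF that] by auto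
  show ?thesis
    unfolding indep_rv_def
  proof (intro conjI indep_setI)
    show "{(\<lambda>\<omega>. f (X \<omega>)) -` A \<inter> space M |A. A \<in> sets N'} \<subseteq> events"
      by auto
    show "{(\<lambda>\<omega>. g (Y \<omega>)) -` A \<inter> space M |A. A \<in> sets L'} \<subseteq> events"
      by auto
    fix a b assume "a \<in> {(\<lambda>\<omega>. f (X \<omega>)) -` A \<inter> space M |A. A \<in> sets N'}"
      "b \<in> {(\<lambda>\<omega>. g (Y \<omega>)) -` A \<inter> space M |A. A \<in> sets L'}"
    then obtain A B where "A \<in> sets N'" "B \<in> sets L'"
        "a = (\<lambda>\<omega>. f (X \<omega>)) -` A \<inter> space M" "b = (\<lambda>\<omega>. g (Y \<omega>)) -` B \<inter> space M" by auto
    then show "prob (a \<inter> b) = prob a * prob b"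
      using indep_rvD[OF XY measurable_sets[OF f] measurable_sets[OF g], of A B]
      by (simp add: vim[of X N f] vim[of Y L g])
  qed measurable
qed

lemma Int_stable_vimage: "Int_stable {X -` A \<inter> space M |A. A \<in> sets N}"
  unfolding Int_stable_def
proof safe
  fix A B assume "A \<in> sets N" "B \<in> sets N"
  then show "\<exists>C. X -` A \<inter> space M \<inter> (X -` B \<inter> space M) = X -` C \<inter> space M \<and> C \<in> sets N"
    by (intro exI[of _ "A \<inter> B"]) auto
qed

lemma indep_rv_imp_indep_var:
  assumes "indep_rv N X L Y"
  shows "indep_var N X L Y"
  unfolding indep_var_eq
  using assms by (intro conjI indep_set_sigma_sets Int_stable_vimage) (auto simp: indep_rv_def)

lemma indep_rv_distr_Pair:
  assumes XY: "indep_rv N X L Y"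
  shows "distr M (N \<Otimes>\<^sub>M L) (\<lambda>\<omega>. (X \<omega>, Y \<omega>)) = distr M N X \<Otimes>\<^sub>M distr M L Y"
proof -
  have X[measurable]: "X \<in> M \<rightarrow>\<^sub>M N" and Y[measurable]: "Y \<in> M \<rightarrow>\<^sub>M L"
    using XY by (auto simp: indep_rv_def)
  interpret X: prob_space "distr M N X" by (rule prob_space_distr[OF X])
  interpret Y: prob_space "distr M L Y" by (rule prob_space_distr[OF Y])
  show ?thesis
  proof (rule pair_measure_eqI[symmetric])
    show "sigma_finite_measure (distr M N X)" "sigma_finite_measure (distr M L Y)"
      by (rule X.sigma_finite_measure_axioms Y.sigma_finite_measure_axioms)+
    show "sets (distr M N X \<Otimes>\<^sub>M distr M L Y) = sets (distr M (N \<Otimes>\<^sub>M L) (\<lambda>\<omega>. (X \<omega>, Y \<omega>)))"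
      by (simp cong: sets_pair_measure_cong)
    fix S T assume "S \<in> sets (distr M N X)" "T \<in> sets (distr M L Y)"
    then have [measurable]: "S \<in> sets N" "T \<in> sets L" by auto
    have "(\<lambda>\<omega>. (X \<omega>, Y \<omega>)) -` (S \<times> T) \<inter> space M = (X -` S \<inter> space M) \<inter> (Y -` T \<inter> space M)" by auto
    then show "emeasure (distr M N X) S * emeasure (distr M L Y) T
        = emeasure (distr M (N \<Otimes>\<^sub>M L) (\<lambda>\<omega>. (X \<omega>, Y \<omega>))) (S \<times> T)"
      by (simp add: emeasure_distr emeasure_eq_measure indep_rvD[OF XY] ennreal_mult)
  qed
qed

text \<open>The intersections of an event of \<open>A i\<close> with an event of \<open>B i\<close> form a generator, stable under
  intersections, of the events of the pair; on it, independence of the pairs follows by first separating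
  the two sequences and then the members of each of them.\<close>

lemma iid_Pair:
  fixes A :: "nat \<Rightarrow> 'a \<Rightarrow> 'b" and B :: "nat \<Rightarrow> 'a \<Rightarrow> 'c"
  assumes A: "iid N A" and B: "iid L B"
    and AB: "indep_rv (\<Pi>\<^sub>M i\<in>UNIV. N) (\<lambda>\<omega> i. A i \<omega>) (\<Pi>\<^sub>M i\<in>UNIV. L) (\<lambda>\<omega> i. B i \<omega>)"
  shows "iid (N \<Otimes>\<^sub>M L) (\<lambda>i \<omega>. (A i \<omega>, B i \<omega>))"
proof -
  note [measurable] = iid_measurable[OF A] iid_measurable[OF B]
  define F where "F = (\<lambda>i. {(A i -` S \<inter> space M) \<inter> (B i -` T \<inter> space M) |S T. S \<in> sets N \<and> T \<in> sets L})"
  have F_Pow: "F i \<subseteq> Pow (space M)" for i by (auto simp: F_def)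
  have "indep_sets F UNIV"
  proof (rule indep_setsI)
    show "F i \<subseteq> events" for i by (auto simp: F_def)
    fix C J assume J: "J \<noteq> {}" "J \<subseteq> UNIV" "finite J" and "\<forall>j\<in>J. C j \<in> F j"
    then have "\<forall>j\<in>J. \<exists>S T. C j = (A j -` S \<inter> space M) \<inter> (B j -` T \<inter> space M) \<and> S \<in> sets N \<and> T \<in> sets L"
      unfolding F_def mem_Collect_eq by simp
    then obtain S T where ST: "\<And>j. j \<in> J \<Longrightarrow> S j \<in> sets N" "\<And>j. j \<in> J \<Longrightarrow> T j \<in> sets L"
        "\<And>j. j \<in> J \<Longrightarrow> C j = (A j -` S j \<inter> space M) \<inter> (B j -` T j \<inter> space M)"
      by metis
    define Q where "Q = {h \<in> space (\<Pi>\<^sub>M i\<in>UNIV. N). \<forall>j\<in>J. h j \<in> S j}"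
    define R where "R = {h \<in> space (\<Pi>\<^sub>M i\<in>UNIV. L). \<forall>j\<in>J. h j \<in> T j}"
    have Q: "Q \<in> sets (\<Pi>\<^sub>M i\<in>UNIV. N)"
      unfolding Q_def using ST(1) J(3)
      by (intro sets.sets_Collect_finite_All) (auto intro!: measurable_sets_Collect[where P="\<lambda>x. x \<in> S _", OF measurable_component_singleton])
    have R: "R \<in> sets (\<Pi>\<^sub>M i\<in>UNIV. L)"
      unfolding R_def using ST(2) J(3)
      by (intro sets.sets_Collect_finite_All) (auto intro!: measurable_sets_Collect[where P="\<lambda>x. x \<in> T _", OF measurable_component_singleton])
    have QA: "(\<lambda>\<omega> i. A i \<omega>) -` Q \<inter> space M = (\<Inter>j\<in>J. A j -` S j \<inter> space M)"
      using J(1) measurable_space[OF iid_measurable[OF A]] by (auto simp: Q_def space_PiM)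
    have RB: "(\<lambda>\<omega> i. B i \<omega>) -` R \<inter> space M = (\<Inter>j\<in>J. B j -` T j \<inter> space M)"
      using J(1) measurable_space[OF iid_measurable[OF B]] by (auto simp: R_def space_PiM)
    have "(\<Inter>j\<in>J. C j) = (\<Inter>j\<in>J. (A j -` S j \<inter> space M) \<inter> (B j -` T j \<inter> space M))"
      using ST(3) by simp
    also have "\<dots> = (\<Inter>j\<in>J. A j -` S j \<inter> space M) \<inter> (\<Inter>j\<in>J. B j -` T j \<inter> space M)" by auto
    finally have "prob (\<Inter>j\<in>J. C j) = prob (\<Inter>j\<in>J. A j -` S j \<inter> space M) * prob (\<Inter>j\<in>J. B j -` T j \<inter> space M)"
      using indep_rvD[OF AB Q R] by (simp add: QA RB)
    also have "\<dots> = (\<Prod>j\<in>J. prob (A j -` S j \<inter> space M)) * (\<Prod>j\<in>J. prob (B j -` T j \<inter> space M))"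
      using indep_varsD[OF iid_indep_vars[OF A] J(1,3,2) ST(1)] indep_varsD[OF iid_indep_vars[OF B] J(1,3,2) ST(2)]
      by simp
    also have "\<dots> = (\<Prod>j\<in>J. prob (C j))"
      unfolding prod.distrib[symmetric]
    proof (rule prod.cong)
      fix j assume j: "j \<in> J"
      have comp: "indep_rv N (A j) L (B j)"
        using indep_rv_compose[OF AB, of "\<lambda>h. h j" N "\<lambda>h. h j" L] by simp
      show "prob (A j -` S j \<inter> space M) * prob (B j -` T j \<inter> space M) = prob (C j)"
        using indep_rvD[OF comp ST(1)[OF j] ST(2)[OF j]] ST(3)[OF j] by simp
    qed simp
    finally show "prob (\<Inter>j\<in>J. C j) = (\<Prod>j\<in>J. prob (C j))" .
  qed
  moreover have "Int_stable (F i)" for i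
    unfolding Int_stable_def F_def
  proof safe
    fix S T S' T' assume "S \<in> sets N" "T \<in> sets L" "S' \<in> sets N" "T' \<in> sets L"
    then show "\<exists>S'' T''. A i -` S \<inter> space M \<inter> (B i -` T \<inter> space M) \<inter> (A i -` S' \<inter> space M \<inter> (B i -` T' \<inter> space M)) =
        A i -` S'' \<inter> space M \<inter> (B i -` T'' \<inter> space M) \<and> S'' \<in> sets N \<and> T'' \<in> sets L"
      by (intro exI[of _ "S \<inter> S'"] exI[of _ "T \<inter> T'"]) auto
  qed
  ultimately have "indep_sets (\<lambda>i. sigma_sets (space M) (F i)) UNIV"
    by (rule indep_sets_sigma)
  moreover have "{(\<lambda>\<omega>. (A i \<omega>, B i \<omega>)) -` C \<inter> space M |C. C \<in> sets (N \<Otimes>\<^sub>M L)} \<subseteq> sigma_sets (space M) (F i)" for i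
  proof -
    let ?G = "sigma (space M) (F i)"
    have sp: "space ?G = space M" and se: "sets ?G = sigma_sets (space M) (F i)"
      using F_Pow by (auto simp: sets_measure_of space_measure_of_conv)
    have "A i \<in> ?G \<rightarrow>\<^sub>M N"
    proof (rule measurableI)
      fix S assume S: "S \<in> sets N"
      have "A i -` S \<inter> space M = (A i -` S \<inter> space M) \<inter> (B i -` space L \<inter> space M)"
        using measurable_space[OF iid_measurable[OF B]] by auto
      then have "A i -` S \<inter> space M \<in> F i" using S unfolding F_def by blast
      then show "A i -` S \<inter> space ?G \<in> sets ?G" unfolding sp se by (rule sigma_sets.Basic)
    qed (use measurable_space[OF iid_measurable[OF A]] sp in auto)
    moreover have "B i \<in> ?G \<rightarrow>\<^sub>M L"
    proof (rule measurableI)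
      fix T assume T: "T \<in> sets L"
      have "B i -` T \<inter> space M = (A i -` space N \<inter> space M) \<inter> (B i -` T \<inter> space M)"
        using measurable_space[OF iid_measurable[OF A]] by auto
      then have "B i -` T \<inter> space M \<in> F i" using T unfolding F_def by blast
      then show "B i -` T \<inter> space ?G \<in> sets ?G" unfolding sp se by (rule sigma_sets.Basic)
    qed (use measurable_space[OF iid_measurable[OF B]] sp in auto)
    ultimately have "(\<lambda>\<omega>. (A i \<omega>, B i \<omega>)) \<in> ?G \<rightarrow>\<^sub>M N \<Otimes>\<^sub>M L" by (rule measurable_Pair)
    from measurable_sets[OF this] show ?thesis unfolding sp se by blast
  qed
  ultimately have "indep_sets (\<lambda>i. {(\<lambda>\<omega>. (A i \<omega>, B i \<omega>)) -` C \<inter> space M |C. C \<in> sets (N \<Otimes>\<^sub>M L)}) UNIV"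
    by (rule indep_sets_mono_sets)
  then have "indep_vars (\<lambda>_. N \<Otimes>\<^sub>M L) (\<lambda>i \<omega>. (A i \<omega>, B i \<omega>)) UNIV"
    unfolding indep_vars_def2 by simp
  moreover have "distr M (N \<Otimes>\<^sub>M L) (\<lambda>\<omega>. (A i \<omega>, B i \<omega>)) = distr M N (A 0) \<Otimes>\<^sub>M distr M L (B 0)" for i
  proof -
    have "indep_rv N (A i) L (B i)"
      using indep_rv_compose[OF AB, of "\<lambda>h. h i" N "\<lambda>h. h i" L] by simp
    from indep_rv_distr_Pair[OF this] show ?thesis
      by (simp add: iid_distr[OF A, of i] iid_distr[OF B, of i])
  qed
  ultimately show ?thesis unfolding iid_def by simp
qed

section \<open>Moments in the structural model\<close>

lemma square_integrable_add:
  fixes f g :: "'a \<Rightarrow> real"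
  assumes "f \<in> borel_measurable M" "g \<in> borel_measurable M"
    and "integrable M (\<lambda>\<omega>. (f \<omega>)\<^sup>2)" "integrable M (\<lambda>\<omega>. (g \<omega>)\<^sup>2)"
  shows "integrable M (\<lambda>\<omega>. (f \<omega> + g \<omega>)\<^sup>2)"
  unfolding power2_sum using assms integrable_mult_of_squares[OF assms] by (simp add: mult.assoc)

lemma square_integrable_cmult:
  fixes f :: "'a \<Rightarrow> real"
  shows "integrable M (\<lambda>\<omega>. (f \<omega>)\<^sup>2) \<Longrightarrow> integrable M (\<lambda>\<omega>. (a * f \<omega>)\<^sup>2)"
  by (simp add: power_mult_distrib)

text \<open>With \<open>\<eta> = d - \<beta> * e\<close> and \<open>k = d * \<eta> - \<kappa>\<close>, which depend on the errors only, \<open>V\<close> is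
  \<open>\<beta> * \<zeta> * \<eta> + k\<close>. By independence the square of \<open>V\<close> involves \<open>\<zeta>\<close> through its first two moments
  only, and replacing the second moment of \<open>\<zeta>\<close> by the square of its mean \<open>a\<close> would leave the second
  moment of \<open>\<beta> * a * \<eta> + k\<close>. The difference is the lower bound, by which the limit law is not
  degenerate.\<close>

lemma structural_moments:
  fixes \<zeta> d e :: "'a \<Rightarrow> real" and \<beta> :: real
  defines "W \<equiv> \<lambda>\<omega>. \<beta> * \<zeta> \<omega> + d \<omega>" and "X \<equiv> \<lambda>\<omega>. \<zeta> \<omega> + e \<omega>"
  defines "\<kappa> \<equiv> expectation (\<lambda>\<omega>. (d \<omega>)\<^sup>2) - \<beta> * expectation (\<lambda>\<omega>. d \<omega> * e \<omega>)"
  defines "V \<equiv> \<lambda>\<omega>. W \<omega> * (W \<omega> - \<beta> * X \<omega>) - \<kappa>"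
  assumes indep: "indep_rv (borel \<Otimes>\<^sub>M borel) (\<lambda>\<omega>. (d \<omega>, e \<omega>)) borel \<zeta>"
    and means: "expectation d = 0" "expectation e = 0"
    and d4: "integrable M (\<lambda>\<omega>. d \<omega> ^ 4)" and e4: "integrable M (\<lambda>\<omega>. e \<omega> ^ 4)"
    and \<zeta>2: "integrable M (\<lambda>\<omega>. (\<zeta> \<omega>)\<^sup>2)"
  shows "integrable M (\<lambda>\<omega>. (W \<omega>)\<^sup>2)" and "integrable M (\<lambda>\<omega>. (X \<omega>)\<^sup>2)" and "integrable M (\<lambda>\<omega>. (V \<omega>)\<^sup>2)"
    and "expectation (\<lambda>\<omega>. (W \<omega>)\<^sup>2) = \<beta>\<^sup>2 * expectation (\<lambda>\<omega>. (\<zeta> \<omega>)\<^sup>2) + expectation (\<lambda>\<omega>. (d \<omega>)\<^sup>2)"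
    and "expectation (\<lambda>\<omega>. W \<omega> * X \<omega>) = \<beta> * expectation (\<lambda>\<omega>. (\<zeta> \<omega>)\<^sup>2) + expectation (\<lambda>\<omega>. d \<omega> * e \<omega>)"
    and "expectation V = 0"
    and "expectation (\<lambda>\<omega>. (V \<omega>)\<^sup>2) \<ge> \<beta>\<^sup>2 * variance \<zeta> * expectation (\<lambda>\<omega>. (d \<omega> - \<beta> * e \<omega>)\<^sup>2)"
proof -
  have \<zeta>[measurable]: "\<zeta> \<in> borel_measurable M" and de: "(\<lambda>\<omega>. (d \<omega>, e \<omega>)) \<in> M \<rightarrow>\<^sub>M borel \<Otimes>\<^sub>M borel"
    using indep by (auto simp: indep_rv_def)
  have d[measurable]: "d \<in> borel_measurable M" and e[measurable]: "e \<in> borel_measurable M"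
    using measurable_compose[OF de measurable_fst] measurable_compose[OF de measurable_snd] by simp_all
  have indep_prod: "integrable M (\<lambda>\<omega>. g (\<zeta> \<omega>) * f (d \<omega>) (e \<omega>)) \<and>
      expectation (\<lambda>\<omega>. g (\<zeta> \<omega>) * f (d \<omega>) (e \<omega>)) = expectation (\<lambda>\<omega>. g (\<zeta> \<omega>)) * expectation (\<lambda>\<omega>. f (d \<omega>) (e \<omega>))"
    if f: "case_prod f \<in> borel_measurable (borel \<Otimes>\<^sub>M borel)" and g: "g \<in> borel_measurable borel"
      and intf: "integrable M (\<lambda>\<omega>. f (d \<omega>) (e \<omega>))" and intg: "integrable M (\<lambda>\<omega>. g (\<zeta> \<omega>))"
    for f :: "real \<Rightarrow> real \<Rightarrow> real" and g :: "real \<Rightarrow> real"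
  proof -
    have iv: "indep_var borel (\<lambda>\<omega>. f (d \<omega>) (e \<omega>)) borel (\<lambda>\<omega>. g (\<zeta> \<omega>))"
      using indep_rv_imp_indep_var[OF indep_rv_compose[OF indep f g]] by simp
    show ?thesis
      using indep_var_integrable[OF iv intf intg] indep_var_lebesgue_integral[OF iv intf intg]
      by (simp add: mult.commute)
  qed
  define \<eta> where "\<eta> = (\<lambda>\<omega>. d \<omega> - \<beta> * e \<omega>)"
  have [measurable]: "\<eta> \<in> borel_measurable M" unfolding \<eta>_def by measurable
  have d22: "integrable M (\<lambda>\<omega>. ((d \<omega>)\<^sup>2)\<^sup>2)" and e22: "integrable M (\<lambda>\<omega>. ((e \<omega>)\<^sup>2)\<^sup>2)"
    using d4 e4 by simp_all
  have d2: "integrable M (\<lambda>\<omega>. (d \<omega>)\<^sup>2)" and e2: "integrable M (\<lambda>\<omega>. (e \<omega>)\<^sup>2)"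
    by (rule square_integrable_imp_integrable[OF _ d22] square_integrable_imp_integrable[OF _ e22]; simp)+
  have d1: "integrable M d" and e1: "integrable M e" and \<zeta>1: "integrable M \<zeta>"
    by (rule square_integrable_imp_integrable[OF _ d2] square_integrable_imp_integrable[OF _ e2]
          square_integrable_imp_integrable[OF _ \<zeta>2]; simp)+
  have de1: "integrable M (\<lambda>\<omega>. d \<omega> * e \<omega>)"
    by (rule integrable_mult_of_squares[OF d e d2 e2])
  have de2: "integrable M (\<lambda>\<omega>. (d \<omega> * e \<omega>)\<^sup>2)"
    using integrable_mult_of_squares[OF _ _ d22 e22] by (simp add: power_mult_distrib)
  have \<eta>2: "integrable M (\<lambda>\<omega>. (\<eta> \<omega>)\<^sup>2)"
    unfolding \<eta>_def using square_integrable_add[OF d _ d2 square_integrable_cmult[OF e2, of "- \<beta>"]] by simp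
  have \<eta>1: "integrable M \<eta>" and \<eta>_mean: "expectation \<eta> = 0"
    unfolding \<eta>_def using d1 e1 means by simp_all
  define k where "k = (\<lambda>\<omega>. d \<omega> * \<eta> \<omega> - \<kappa>)"
  have [measurable]: "k \<in> borel_measurable M" unfolding k_def by measurable
  have k_eq: "k \<omega> = (d \<omega>)\<^sup>2 - \<beta> * (d \<omega> * e \<omega>) - \<kappa>" for \<omega>
    by (simp add: k_def \<eta>_def power2_eq_square algebra_simps)
  have k1: "integrable M k" and k_mean: "expectation k = 0"
    unfolding k_eq[abs_def] using d2 de1 by (simp_all add: \<kappa>_def prob_space)
  have k2: "integrable M (\<lambda>\<omega>. (k \<omega>)\<^sup>2)"
  proof -
    have "integrable M (\<lambda>\<omega>. (((d \<omega>)\<^sup>2 + - \<beta> * (d \<omega> * e \<omega>)) + - \<kappa>)\<^sup>2)"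
      by (intro square_integrable_add square_integrable_cmult d22 de2) simp_all
    then show ?thesis by (simp add: k_eq)
  qed
  have V_eq: "V \<omega> = \<beta> * (\<zeta> \<omega> * \<eta> \<omega>) + k \<omega>" for \<omega>
    unfolding V_def W_def X_def k_def \<eta>_def by algebra
  have id: "(\<lambda>s::real. s) \<in> borel_measurable borel" by measurable
  have \<zeta>d: "integrable M (\<lambda>\<omega>. \<zeta> \<omega> * d \<omega>)" "expectation (\<lambda>\<omega>. \<zeta> \<omega> * d \<omega>) = 0"
  proof -
    have "case_prod (\<lambda>s t. s) \<in> borel_measurable (borel \<Otimes>\<^sub>M (borel :: real measure))" by measurable
    from indep_prod[OF this id d1 \<zeta>1] show "integrable M (\<lambda>\<omega>. \<zeta> \<omega> * d \<omega>)" "expectation (\<lambda>\<omega>. \<zeta> \<omega> * d \<omega>) = 0"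
      by (simp_all only: means mult_zero_right)
  qed
  have \<zeta>e: "integrable M (\<lambda>\<omega>. \<zeta> \<omega> * e \<omega>)" "expectation (\<lambda>\<omega>. \<zeta> \<omega> * e \<omega>) = 0"
  proof -
    have "case_prod (\<lambda>s t. t) \<in> borel_measurable ((borel :: real measure) \<Otimes>\<^sub>M borel)" by measurable
    from indep_prod[OF this id e1 \<zeta>1] show "integrable M (\<lambda>\<omega>. \<zeta> \<omega> * e \<omega>)" "expectation (\<lambda>\<omega>. \<zeta> \<omega> * e \<omega>) = 0"
      by (simp_all only: means mult_zero_right)
  qed
  have \<zeta>\<eta>: "integrable M (\<lambda>\<omega>. \<zeta> \<omega> * \<eta> \<omega>)" "expectation (\<lambda>\<omega>. \<zeta> \<omega> * \<eta> \<omega>) = 0"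
  proof -
    have "case_prod (\<lambda>s t. s - \<beta> * t) \<in> borel_measurable (borel \<Otimes>\<^sub>M borel)" by measurable
    from indep_prod[OF this id \<eta>1[unfolded \<eta>_def] \<zeta>1]
    show "integrable M (\<lambda>\<omega>. \<zeta> \<omega> * \<eta> \<omega>)" "expectation (\<lambda>\<omega>. \<zeta> \<omega> * \<eta> \<omega>) = 0"
      by (simp_all only: \<eta>_mean[unfolded \<eta>_def] mult_zero_right \<eta>_def)
  qed
  have \<zeta>\<eta>2: "integrable M (\<lambda>\<omega>. (\<zeta> \<omega>)\<^sup>2 * (\<eta> \<omega>)\<^sup>2)"
      "expectation (\<lambda>\<omega>. (\<zeta> \<omega>)\<^sup>2 * (\<eta> \<omega>)\<^sup>2) = expectation (\<lambda>\<omega>. (\<zeta> \<omega>)\<^sup>2) * expectation (\<lambda>\<omega>. (\<eta> \<omega>)\<^sup>2)"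
  proof -
    have f: "case_prod (\<lambda>s t. (s - \<beta> * t)\<^sup>2) \<in> borel_measurable (borel \<Otimes>\<^sub>M borel)"
      and g: "(\<lambda>s::real. s\<^sup>2) \<in> borel_measurable borel" by measurable
    from indep_prod[OF f g \<eta>2[unfolded \<eta>_def] \<zeta>2]
    show "integrable M (\<lambda>\<omega>. (\<zeta> \<omega>)\<^sup>2 * (\<eta> \<omega>)\<^sup>2)"
      "expectation (\<lambda>\<omega>. (\<zeta> \<omega>)\<^sup>2 * (\<eta> \<omega>)\<^sup>2) = expectation (\<lambda>\<omega>. (\<zeta> \<omega>)\<^sup>2) * expectation (\<lambda>\<omega>. (\<eta> \<omega>)\<^sup>2)"
      by (simp_all only: \<eta>_def)
  qed
  have \<eta>k: "integrable M (\<lambda>\<omega>. \<eta> \<omega> * k \<omega>)"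
    by (rule integrable_mult_of_squares[OF _ _ \<eta>2 k2]) simp_all
  have \<zeta>\<eta>k: "integrable M (\<lambda>\<omega>. \<zeta> \<omega> * (\<eta> \<omega> * k \<omega>))"
      "expectation (\<lambda>\<omega>. \<zeta> \<omega> * (\<eta> \<omega> * k \<omega>)) = expectation \<zeta> * expectation (\<lambda>\<omega>. \<eta> \<omega> * k \<omega>)"
  proof -
    have f: "case_prod (\<lambda>s t. (s - \<beta> * t) * (s * (s - \<beta> * t) - \<kappa>)) \<in> borel_measurable (borel \<Otimes>\<^sub>M borel)"
      by measurable
    from indep_prod[OF f id \<eta>k[unfolded \<eta>_def k_def] \<zeta>1]
    show "integrable M (\<lambda>\<omega>. \<zeta> \<omega> * (\<eta> \<omega> * k \<omega>))"
      "expectation (\<lambda>\<omega>. \<zeta> \<omega> * (\<eta> \<omega> * k \<omega>)) = expectation \<zeta> * expectation (\<lambda>\<omega>. \<eta> \<omega> * k \<omega>)"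
      by (simp_all only: \<eta>_def k_def)
  qed
  have W_eq: "(W \<omega>)\<^sup>2 = \<beta>\<^sup>2 * (\<zeta> \<omega>)\<^sup>2 + 2 * \<beta> * (\<zeta> \<omega> * d \<omega>) + (d \<omega>)\<^sup>2" for \<omega>
    by (simp add: W_def power2_eq_square algebra_simps)
  show "integrable M (\<lambda>\<omega>. (W \<omega>)\<^sup>2)" using \<zeta>2 \<zeta>d d2 by (simp add: W_eq)
  show "expectation (\<lambda>\<omega>. (W \<omega>)\<^sup>2) = \<beta>\<^sup>2 * expectation (\<lambda>\<omega>. (\<zeta> \<omega>)\<^sup>2) + expectation (\<lambda>\<omega>. (d \<omega>)\<^sup>2)"
    using \<zeta>2 \<zeta>d d2 by (simp add: W_eq)
  show "integrable M (\<lambda>\<omega>. (X \<omega>)\<^sup>2)" unfolding X_def by (rule square_integrable_add[OF \<zeta> e \<zeta>2 e2])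
  have "W \<omega> * X \<omega> = \<beta> * (\<zeta> \<omega>)\<^sup>2 + \<beta> * (\<zeta> \<omega> * e \<omega>) + \<zeta> \<omega> * d \<omega> + d \<omega> * e \<omega>" for \<omega>
    by (simp add: W_def X_def power2_eq_square algebra_simps)
  then show "expectation (\<lambda>\<omega>. W \<omega> * X \<omega>) = \<beta> * expectation (\<lambda>\<omega>. (\<zeta> \<omega>)\<^sup>2) + expectation (\<lambda>\<omega>. d \<omega> * e \<omega>)"
    using \<zeta>2 \<zeta>d \<zeta>e de1 by simp
  show "expectation V = 0" unfolding V_eq[abs_def] using \<zeta>\<eta> k1 k_mean by simp
  have V2_eq: "(V \<omega>)\<^sup>2 = \<beta>\<^sup>2 * ((\<zeta> \<omega>)\<^sup>2 * (\<eta> \<omega>)\<^sup>2) + 2 * \<beta> * (\<zeta> \<omega> * (\<eta> \<omega> * k \<omega>)) + (k \<omega>)\<^sup>2" for \<omega>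
    unfolding V_eq by algebra
  show "integrable M (\<lambda>\<omega>. (V \<omega>)\<^sup>2)" using \<zeta>\<eta>2 \<zeta>\<eta>k k2 by (simp add: V2_eq)
  let ?a = "expectation \<zeta>"
  have "0 \<le> expectation (\<lambda>\<omega>. (\<beta> * ?a * \<eta> \<omega> + k \<omega>)\<^sup>2)" by simp
  also have "(\<lambda>\<omega>. (\<beta> * ?a * \<eta> \<omega> + k \<omega>)\<^sup>2) = (\<lambda>\<omega>. \<beta>\<^sup>2 * ?a\<^sup>2 * (\<eta> \<omega>)\<^sup>2 + 2 * \<beta> * ?a * (\<eta> \<omega> * k \<omega>) + (k \<omega>)\<^sup>2)"
    by (rule ext) algebra
  also have "expectation \<dots> = \<beta>\<^sup>2 * ?a\<^sup>2 * expectation (\<lambda>\<omega>. (\<eta> \<omega>)\<^sup>2)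
      + 2 * \<beta> * ?a * expectation (\<lambda>\<omega>. \<eta> \<omega> * k \<omega>) + expectation (\<lambda>\<omega>. (k \<omega>)\<^sup>2)"
    using \<eta>2 \<eta>k k2 by simp
  finally have "0 \<le> \<beta>\<^sup>2 * ?a\<^sup>2 * expectation (\<lambda>\<omega>. (\<eta> \<omega>)\<^sup>2)
      + 2 * \<beta> * ?a * expectation (\<lambda>\<omega>. \<eta> \<omega> * k \<omega>) + expectation (\<lambda>\<omega>. (k \<omega>)\<^sup>2)" .
  moreover have "expectation (\<lambda>\<omega>. (V \<omega>)\<^sup>2) = \<beta>\<^sup>2 * (expectation (\<lambda>\<omega>. (\<zeta> \<omega>)\<^sup>2) * expectation (\<lambda>\<omega>. (\<eta> \<omega>)\<^sup>2))
      + 2 * \<beta> * (?a * expectation (\<lambda>\<omega>. \<eta> \<omega> * k \<omega>)) + expectation (\<lambda>\<omega>. (k \<omega>)\<^sup>2)"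
    using \<zeta>\<eta>2 \<zeta>\<eta>k k2 by (simp add: V2_eq)
  moreover have "\<beta>\<^sup>2 * variance \<zeta> * expectation (\<lambda>\<omega>. (\<eta> \<omega>)\<^sup>2)
      = \<beta>\<^sup>2 * (expectation (\<lambda>\<omega>. (\<zeta> \<omega>)\<^sup>2) * expectation (\<lambda>\<omega>. (\<eta> \<omega>)\<^sup>2))
        - \<beta>\<^sup>2 * ?a\<^sup>2 * expectation (\<lambda>\<omega>. (\<eta> \<omega>)\<^sup>2)"
    unfolding variance_eq[OF \<zeta>1 \<zeta>2] by (simp only: right_diff_distrib left_diff_distrib mult.assoc)
  ultimately have "expectation (\<lambda>\<omega>. (V \<omega>)\<^sup>2) \<ge> \<beta>\<^sup>2 * variance \<zeta> * expectation (\<lambda>\<omega>. (\<eta> \<omega>)\<^sup>2)"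
    by (simp only: mult.assoc)
  then show "expectation (\<lambda>\<omega>. (V \<omega>)\<^sup>2) \<ge> \<beta>\<^sup>2 * variance \<zeta> * expectation (\<lambda>\<omega>. (d \<omega> - \<beta> * e \<omega>)\<^sup>2)"
    by (simp only: \<eta>_def)
qed

end

lemma (in prob_space) covariance_matrix_entries:
  assumes cov: "covariance_matrix d e = vector [vector [a, b], vector [b', t]]"
    and means: "expectation d = 0" "expectation e = 0"
  shows "expectation (\<lambda>\<omega>. (d \<omega>)\<^sup>2) = a" "expectation (\<lambda>\<omega>. d \<omega> * e \<omega>) = b"
    "expectation (\<lambda>\<omega>. (e \<omega>)\<^sup>2) = t"
proof -
  have "covariance_matrix d e $ i $ j = (vector [vector [a, b], vector [b', t]] :: real^2^2) $ i $ j" for i j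
    using cov by simp
  from this[of 1 1] this[of 1 2] this[of 2 2]
  show "expectation (\<lambda>\<omega>. (d \<omega>)\<^sup>2) = a" "expectation (\<lambda>\<omega>. d \<omega> * e \<omega>) = b"
    "expectation (\<lambda>\<omega>. (e \<omega>)\<^sup>2) = t"
    by (simp_all add: covariance_matrix_def covariance_def means)
qed

text \<open>The quadratic form at the vector \<open>(1, -s)\<close>.\<close>

lemma positive_definite_quadratic_form:
  assumes "positive_definite (vector [vector [a, b], vector [b, t]] :: real^2^2)"
  shows "a - 2 * s * b + s\<^sup>2 * t > 0"
proof -
  let ?v = "vector [1, - s] :: real^2"
  have "?v \<noteq> 0" by (metis vector_2(1) zero_index zero_neq_one)
  then have "?v \<bullet> ((vector [vector [a, b], vector [b, t]] :: real^2^2) *v ?v) > 0"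
    using assms by (simp add: positive_definite_def)
  then show ?thesis
    by (simp add: inner_vec_def matrix_vector_mult_def sum_2 algebra_simps power2_eq_square)
qed

lemma (in prob_space) variance_pos_of_not_const:
  fixes X :: "'a \<Rightarrow> real"
  assumes [measurable]: "X \<in> borel_measurable M" and X2: "integrable M (\<lambda>\<omega>. (X \<omega>)\<^sup>2)"
    and not_const: "\<not> (\<exists>m. AE \<omega> in M. X \<omega> = m)"
  shows "variance X > 0"
proof -
  let ?m = "expectation X"
  have X1: "integrable M X" by (rule square_integrable_imp_integrable[OF _ X2]) simp
  have int: "integrable M (\<lambda>\<omega>. (X \<omega> - ?m)\<^sup>2)"
    unfolding power2_diff using X1 X2 by simp
  have "variance X \<noteq> 0"
  proof
    assume "variance X = 0"
    then have "AE \<omega> in M. (X \<omega> - ?m)\<^sup>2 = 0"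
      using integral_nonneg_eq_0_iff_AE[OF int] by simp
    then have "AE \<omega> in M. X \<omega> = ?m" by eventually_elim simp
    with not_const show False by blast
  qed
  with variance_positive[of X] show ?thesis by linarith
qed

lemma (in finite_measure) integrable_square_of_powr:
  fixes X :: "'a \<Rightarrow> real"
  assumes [measurable]: "X \<in> borel_measurable M" and int: "integrable M (\<lambda>\<omega>. \<bar>X \<omega>\<bar> powr p)" and "2 \<le> p"
  shows "integrable M (\<lambda>\<omega>. (X \<omega>)\<^sup>2)"
proof (rule Bochner_Integration.integrable_bound)
  show "integrable M (\<lambda>\<omega>. 1 + \<bar>X \<omega>\<bar> powr p)" using int by simp
  have "s\<^sup>2 \<le> 1 + \<bar>s\<bar> powr p" for s :: real
  proof (cases "\<bar>s\<bar> \<le> 1")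
    case True
    then have "s\<^sup>2 \<le> 1" by (simp add: abs_square_le_1)
    then show ?thesis by (simp add: add_increasing2)
  next
    case False
    then have "s\<^sup>2 = \<bar>s\<bar> powr 2" by (subst powr_numeral) auto
    also have "\<dots> \<le> \<bar>s\<bar> powr p" using False \<open>2 \<le> p\<close> by (intro powr_mono) auto
    finally show ?thesis by simp
  qed
  then show "AE \<omega> in M. norm ((X \<omega>)\<^sup>2) \<le> norm (1 + \<bar>X \<omega>\<bar> powr p)"
    by (simp add: add_nonneg_nonneg)
qed measurable

section \<open>Confidence intervals for the slope\<close>

theorem theorem4:
  fixes M :: "'a measure"
    and \<xi> \<delta> \<epsilon> x y :: "nat \<Rightarrow> 'a \<Rightarrow> real"
    and \<alpha> \<beta> lam \<theta> \<mu> c \<gamma> :: real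
  assumes "prob_space M"
    \<comment> \<open>the model\<close>
    and "\<And>i \<omega>. i \<ge> 1 \<Longrightarrow> \<omega> \<in> space M \<Longrightarrow> y i \<omega> = \<beta> * \<xi> i \<omega> + \<alpha> + \<delta> i \<omega>"
    and "\<And>i \<omega>. i \<ge> 1 \<Longrightarrow> \<omega> \<in> space M \<Longrightarrow> x i \<omega> = \<xi> i \<omega> + \<epsilon> i \<omega>"
    and "\<beta> \<noteq> 0"
    and "(\<alpha> = 0 \<and> c = 0) \<or> c = 1"
    \<comment> \<open>the errors\<close>
    and "prob_space.iid M (borel \<Otimes>\<^sub>M borel) (\<lambda>i \<omega>. (\<delta> i \<omega>, \<epsilon> i \<omega>))"
    and "integral\<^sup>L M (\<delta> 0) = 0" and "integral\<^sup>L M (\<epsilon> 0) = 0"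
    and "integrable M (\<lambda>\<omega>. \<delta> 0 \<omega> ^ 4)" and "integrable M (\<lambda>\<omega>. \<epsilon> 0 \<omega> ^ 4)"
    and "prob_space.covariance_matrix M (\<delta> 0) (\<epsilon> 0) = vector [vector [lam * \<theta>, \<mu>], vector [\<mu>, \<theta>]]"
    and "positive_definite (vector [vector [lam * \<theta>, \<mu>], vector [\<mu>, \<theta>]] :: real^2^2)"
    \<comment> \<open>the explanatory variables\<close>
    and "prob_space.iid M borel \<xi>"
    and "integrable M (\<lambda>\<omega>. \<bar>\<xi> 0 \<omega>\<bar> powr (8 / 3))"
    and "\<not> (\<exists>m. AE \<omega> in M. \<xi> 0 \<omega> = m)"
    \<comment> \<open>independence of errors and explanatory variables\<close>
    and "prob_space.indep_rv M
           (\<Pi>\<^sub>M i\<in>UNIV. borel \<Otimes>\<^sub>M borel) (\<lambda>\<omega> i. (\<delta> i \<omega>, \<epsilon> i \<omega>))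
           (\<Pi>\<^sub>M i\<in>UNIV. borel) (\<lambda>\<omega> i. \<xi> i \<omega>)"
    and "0 < \<gamma>" and "\<gamma> < 1"
  shows "prob_space.normal_attraction M \<xi> \<and>
    (\<forall>k\<in>{1, 2}.
       (\<lambda>n. let z = std_normal_quantile (1 - \<gamma> / 2) in
          measure M {\<omega> \<in> space M.
            limits_defined k c (lam * \<theta>) \<mu> z n (\<lambda>i. x i \<omega>) (\<lambda>i. y i \<omega>) \<and>
            \<beta> \<in> {B_limit k 1 c (lam * \<theta>) \<mu> z n (\<lambda>i. x i \<omega>) (\<lambda>i. y i \<omega>) ..
                  B_limit k 2 c (lam * \<theta>) \<mu> z n (\<lambda>i. x i \<omega>) (\<lambda>i. y i \<omega>)}})
       \<longlonglongrightarrow> 1 - \<gamma>)"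
proof -
  interpret prob_space M by fact
  note y = assms(2) and x = assms(3) and \<beta> = assms(4) and \<alpha>c = assms(5)
    and errors = assms(6) and means = assms(7,8) and moments = assms(9,10) and cov = assms(11)
    and pd = assms(12) and \<xi> = assms(13) and powr = assms(14) and not_const = assms(15)
    and indep = assms(16) and \<gamma> = assms(17,18)
  note [measurable] = iid_measurable[OF \<xi>]
  have \<xi>2: "integrable M (\<lambda>\<omega>. (\<xi> 0 \<omega>)\<^sup>2)"
    by (rule integrable_square_of_powr[OF _ powr]) simp_all
  have \<xi>1: "integrable M (\<xi> 0)"
    by (rule square_integrable_imp_integrable[OF _ \<xi>2]) simp
  have var: "variance (\<xi> 0) > 0"
    by (rule variance_pos_of_not_const[OF _ \<xi>2 not_const]) simp
  define m where "m = expectation (\<xi> 0)"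
  \<comment> \<open>centring is permitted only where the sample mean is subtracted, that is for \<open>c = 1\<close>\<close>
  define \<zeta> where "\<zeta> = (\<lambda>i \<omega>. \<xi> i \<omega> - c * m)"
  define W where "W = (\<lambda>i \<omega>. \<beta> * \<zeta> i \<omega> + \<delta> i \<omega>)"
  define X where "X = (\<lambda>i \<omega>. \<zeta> i \<omega> + \<epsilon> i \<omega>)"
  have c: "c * c = c" using \<alpha>c by auto
  have \<zeta>2: "integrable M (\<lambda>\<omega>. (\<zeta> 0 \<omega>)\<^sup>2)"
    unfolding \<zeta>_def power2_diff using \<xi>1 \<xi>2 by simp
  have \<zeta>1: "integrable M (\<zeta> 0)" and \<zeta>_mean: "expectation (\<zeta> 0) = m - c * m"
    unfolding \<zeta>_def using \<xi>1 by (simp_all add: m_def prob_space)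
  have \<zeta>_var: "variance (\<zeta> 0) = variance (\<xi> 0)"
    unfolding \<zeta>_mean by (simp add: \<zeta>_def m_def)
  have \<zeta>2_pos: "expectation (\<lambda>\<omega>. (\<zeta> 0 \<omega>)\<^sup>2) > 0"
    using var variance_eq[OF \<zeta>1 \<zeta>2] zero_le_power2[of "expectation (\<zeta> 0)"] unfolding \<zeta>_var by linarith
  have indep0: "indep_rv (borel \<Otimes>\<^sub>M borel) (\<lambda>\<omega>. (\<delta> 0 \<omega>, \<epsilon> 0 \<omega>)) borel (\<zeta> 0)"
    unfolding \<zeta>_def
    using indep_rv_compose[OF indep, of "\<lambda>h. h 0" "borel \<Otimes>\<^sub>M borel" "\<lambda>h. h 0 - c * m" borel] by simp
  have "iid (borel \<Otimes>\<^sub>M borel) (\<lambda>i \<omega>. (\<lambda>p. (\<beta> * (snd p - c * m) + fst (fst p), (snd p - c * m) + snd (fst p)))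
      ((\<delta> i \<omega>, \<epsilon> i \<omega>), \<xi> i \<omega>))"
    by (rule iid_compose[OF iid_Pair[OF errors \<xi> indep]]) measurable
  then have iid: "iid (borel \<Otimes>\<^sub>M borel) (\<lambda>i \<omega>. (W i \<omega>, X i \<omega>))"
    by (simp add: W_def X_def \<zeta>_def)
  have error_pair: "(\<lambda>\<omega>. (\<delta> 0 \<omega>, \<epsilon> 0 \<omega>)) \<in> M \<rightarrow>\<^sub>M borel \<Otimes>\<^sub>M borel"
    by (rule iid_measurable[OF errors])
  have [measurable]: "\<delta> 0 \<in> borel_measurable M" "\<epsilon> 0 \<in> borel_measurable M"
    using measurable_compose[OF error_pair measurable_fst] measurable_compose[OF error_pair measurable_snd] by simp_all
  note entries = covariance_matrix_entries[OF cov means]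
  note mom = structural_moments(1,3-7)[OF indep0 means moments \<zeta>2, where \<beta> = \<beta>, unfolded entries]
    structural_moments(2)[OF indep0 means moments \<zeta>2]
  have d2: "integrable M (\<lambda>\<omega>. (\<delta> 0 \<omega>)\<^sup>2)" and e2: "integrable M (\<lambda>\<omega>. (\<epsilon> 0 \<omega>)\<^sup>2)"
    by (rule square_integrable_imp_integrable; use moments in simp)+
  have d1: "integrable M (\<delta> 0)" and e1: "integrable M (\<epsilon> 0)"
    by (rule square_integrable_imp_integrable[OF _ d2] square_integrable_imp_integrable[OF _ e2]; simp)+
  have "expectation (\<lambda>\<omega>. (\<delta> 0 \<omega> - \<beta> * \<epsilon> 0 \<omega>)\<^sup>2) = lam * \<theta> - 2 * \<beta> * \<mu> + \<beta>\<^sup>2 * \<theta>"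
  proof -
    have "(\<delta> 0 \<omega> - \<beta> * \<epsilon> 0 \<omega>)\<^sup>2 = (\<delta> 0 \<omega>)\<^sup>2 - 2 * \<beta> * (\<delta> 0 \<omega> * \<epsilon> 0 \<omega>) + \<beta>\<^sup>2 * (\<epsilon> 0 \<omega>)\<^sup>2" for \<omega>
      by (simp add: power2_eq_square algebra_simps)
    then show ?thesis
      using d2 e2 integrable_mult_of_squares[OF _ _ d2 e2] by (simp add: entries)
  qed
  then have "expectation (\<lambda>\<omega>. (\<delta> 0 \<omega> - \<beta> * \<epsilon> 0 \<omega>)\<^sup>2) > 0"
    using positive_definite_quadratic_form[OF pd, of \<beta>] by simp
  then have V2_pos: "\<beta>\<^sup>2 * variance (\<zeta> 0) * expectation (\<lambda>\<omega>. (\<delta> 0 \<omega> - \<beta> * \<epsilon> 0 \<omega>)\<^sup>2) > 0"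
    using var \<beta> unfolding \<zeta>_var by (intro mult_pos_pos) auto
  have centred: "c * expectation (W 0) = 0" "c * expectation (X 0) = 0"
  proof -
    have "c * expectation (\<zeta> 0) = 0"
      unfolding \<zeta>_mean by (simp add: right_diff_distrib mult.assoc[symmetric] c)
    then show "c * expectation (W 0) = 0" "c * expectation (X 0) = 0"
      unfolding W_def X_def using \<zeta>1 d1 e1 means by auto
  qed
  define z where "z = std_normal_quantile (1 - \<gamma> / 2)"
  have z: "z > 0" "2 * cdf std_normal_distribution z - 1 = 1 - \<gamma>"
    using std_normal_quantile_pos[of "1 - \<gamma> / 2"] std_normal_quantile[of "1 - \<gamma> / 2"] \<gamma> by (auto simp: z_def)
  have coverage: "(\<lambda>n. prob {\<omega> \<in> space M.
            limits_defined k c (lam * \<theta>) \<mu> z n (\<lambda>i. X i \<omega>) (\<lambda>i. W i \<omega>) \<and>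
            \<beta> \<in> {B_limit k 1 c (lam * \<theta>) \<mu> z n (\<lambda>i. X i \<omega>) (\<lambda>i. W i \<omega>) ..
                  B_limit k 2 c (lam * \<theta>) \<mu> z n (\<lambda>i. X i \<omega>) (\<lambda>i. W i \<omega>)}}) \<longlonglongrightarrow> 1 - \<gamma>" for k
    unfolding z(2)[symmetric]
  proof (rule interval_coverage[OF iid c centred _ _ _ _ _ _ _ z(1)])
    show "expectation (\<lambda>\<omega>. (W 0 \<omega>)\<^sup>2) > lam * \<theta>" "expectation (\<lambda>\<omega>. W 0 \<omega> * X 0 \<omega>) \<noteq> \<mu>"
      using mom(3,4) \<beta> \<zeta>2_pos by (simp_all add: W_def X_def)
  qed (use mom V2_pos in \<open>simp_all add: W_def X_def\<close>)
  have same: "limits_defined k c (lam * \<theta>) \<mu> z n (\<lambda>i. x i \<omega>) (\<lambda>i. y i \<omega>) =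
        limits_defined k c (lam * \<theta>) \<mu> z n (\<lambda>i. X i \<omega>) (\<lambda>i. W i \<omega>)"
      "B_limit k l c (lam * \<theta>) \<mu> z n (\<lambda>i. x i \<omega>) (\<lambda>i. y i \<omega>) =
        B_limit k l c (lam * \<theta>) \<mu> z n (\<lambda>i. X i \<omega>) (\<lambda>i. W i \<omega>)"
    if \<omega>: "\<omega> \<in> space M" for k l n \<omega>
  proof -
    have Y: "y j \<omega> = W j \<omega> + c * (\<alpha> + \<beta> * m)" "x j \<omega> = X j \<omega> + c * m" if "j \<in> {1..n}" for j
      using x[OF _ \<omega>, of j] y[OF _ \<omega>, of j] that \<alpha>c by (auto simp: W_def X_def \<zeta>_def algebra_simps)
    have s: "s_term c n (\<lambda>i. y i \<omega>) (\<lambda>i. y i \<omega>) i = s_term c n (\<lambda>i. W i \<omega>) (\<lambda>i. W i \<omega>) i"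
        "s_term c n (\<lambda>i. x i \<omega>) (\<lambda>i. y i \<omega>) i = s_term c n (\<lambda>i. X i \<omega>) (\<lambda>i. W i \<omega>) i"
      if i: "i \<in> {1..n}" for i
      by (rule s_term_shift[OF c _ Y(1) Y(1) i] s_term_shift[OF c _ Y(2) Y(1) i]; use i in simp)+
    show "limits_defined k c (lam * \<theta>) \<mu> z n (\<lambda>i. x i \<omega>) (\<lambda>i. y i \<omega>) =
        limits_defined k c (lam * \<theta>) \<mu> z n (\<lambda>i. X i \<omega>) (\<lambda>i. W i \<omega>)"
      by (rule confidence_limits_cong(1)) (rule s, assumption)+
    show "B_limit k l c (lam * \<theta>) \<mu> z n (\<lambda>i. x i \<omega>) (\<lambda>i. y i \<omega>) =
        B_limit k l c (lam * \<theta>) \<mu> z n (\<lambda>i. X i \<omega>) (\<lambda>i. W i \<omega>)"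
      by (rule confidence_limits_cong(2)) (rule s, assumption)+
  qed
  show ?thesis
    unfolding Let_def z_def[symmetric]
  proof (intro conjI ballI)
    show "normal_attraction \<xi>" by (rule iid_normal_attraction[OF \<xi> \<xi>2 var])
    fix k :: nat assume "k \<in> {1, 2}"
    have same_event: "{\<omega> \<in> space M. limits_defined k c (lam * \<theta>) \<mu> z n (\<lambda>i. x i \<omega>) (\<lambda>i. y i \<omega>) \<and>
            \<beta> \<in> {B_limit k 1 c (lam * \<theta>) \<mu> z n (\<lambda>i. x i \<omega>) (\<lambda>i. y i \<omega>) ..
                  B_limit k 2 c (lam * \<theta>) \<mu> z n (\<lambda>i. x i \<omega>) (\<lambda>i. y i \<omega>)}} =
          {\<omega> \<in> space M. limits_defined k c (lam * \<theta>) \<mu> z n (\<lambda>i. X i \<omega>) (\<lambda>i. W i \<omega>) \<and>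
            \<beta> \<in> {B_limit k 1 c (lam * \<theta>) \<mu> z n (\<lambda>i. X i \<omega>) (\<lambda>i. W i \<omega>) ..
                  B_limit k 2 c (lam * \<theta>) \<mu> z n (\<lambda>i. X i \<omega>) (\<lambda>i. W i \<omega>)}}" for n
      by (intro Collect_cong conj_cong refl) (simp_all only: same)
    show "(\<lambda>n. prob {\<omega> \<in> space M. limits_defined k c (lam * \<theta>) \<mu> z n (\<lambda>i. x i \<omega>) (\<lambda>i. y i \<omega>) \<and>
            \<beta> \<in> {B_limit k 1 c (lam * \<theta>) \<mu> z n (\<lambda>i. x i \<omega>) (\<lambda>i. y i \<omega>) ..
                  B_limit k 2 c (lam * \<theta>) \<mu> z n (\<lambda>i. x i \<omega>) (\<lambda>i. y i \<omega>)}}) \<longlonglongrightarrow> 1 - \<gamma>"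
      unfolding same_event by (rule coverage)
  qed
qed

end
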